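(* Let $\mathbf V$ be a monoid variety whose membership problem is decidable (given a finite monoid, decide whether it belongs to $\mathbf V$). Then there is an algorithm that, given a DFT $T$, decides whether the function defined by $T$ is definable by some $\mathbf V$-DFT.
   Context: A (real-time) deterministic finite state transducer (DFT) over $\Sigma$ is $T=(Q,q_0,F,\delta,i,t)$ with a partial transition function $\delta:Q\times\Sigma\to Q\times\Sigma^\ast$, final states $F$, initial output $i$ and terminal output $t:F\to\Sigma^\ast$; it maps $u$ to $i\,w\,t(q)$ if reading $u$ from $q_0$ reaches $q\in F$ while producing $w$. The underlying automaton forgets outputs. Its transition monoid is $\Sigma^\ast/\equiv$ where $u\equiv v$ iff for all states $p,q$ there is a run from $p$ to $q$ on $u$ iff there is one on $v$. A $\mathbf V$-DFT is a DFT whose transition monoid lies in $\mathbf V$. *)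

theory Defs
  imports Main "HOL-Library.Nat_Bijection"
begin

datatype recf = Zr | Sc | Proj nat | Comp recf "recf list" | Prim recf recf | Mn recf

inductive eval_rf :: "recf \<Rightarrow> nat list \<Rightarrow> nat \<Rightarrow> bool" where
  ev_Z: "eval_rf Zr xs 0"
| ev_S: "eval_rf Sc (x # xs) (Suc x)"
| ev_Proj: "i < length xs \<Longrightarrow> eval_rf (Proj i) xs (xs ! i)"
| ev_Comp: "list_all2 (\<lambda>g y. eval_rf g xs y) gs ys \<Longrightarrow> eval_rf f ys z
            \<Longrightarrow> eval_rf (Comp f gs) xs z"
| ev_Prim0: "eval_rf f xs y \<Longrightarrow> eval_rf (Prim f g) (0 # xs) y"
| ev_PrimS: "eval_rf (Prim f g) (n # xs) y \<Longrightarrow> eval_rf g (n # y # xs) z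
            \<Longrightarrow> eval_rf (Prim f g) (Suc n # xs) z"
| ev_Mn: "eval_rf f (n # xs) 0 \<Longrightarrow> (\<forall>m<n. \<exists>y. 0 < y \<and> eval_rf f (m # xs) y)
            \<Longrightarrow> eval_rf (Mn f) xs n"

datatype sexp = Atom nat | Lst "sexp list"

fun sexp_nat :: "sexp \<Rightarrow> nat" where
  "sexp_nat (Atom n) = prod_encode (0, n)"
| "sexp_nat (Lst xs) = prod_encode (1, list_encode (map sexp_nat xs))"

definition natlist :: "nat list \<Rightarrow> sexp" where
  "natlist xs = Lst (map Atom xs)"

definition decides :: "recf \<Rightarrow> ('a \<Rightarrow> sexp) \<Rightarrow> ('a \<Rightarrow> bool) \<Rightarrow> ('a \<Rightarrow> bool) \<Rightarrow> bool" where
  "decides f enc D P \<longleftrightarrow>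
     (\<forall>x. D x \<longrightarrow> eval_rf f [sexp_nat (enc x)] (if P x then 1 else 0))"

text \<open>(m, e, mul): carrier {0..<m}, unit e, multiplication mul (relevant on the carrier).\<close>
type_synonym mtable = "nat \<times> nat \<times> (nat \<Rightarrow> nat \<Rightarrow> nat)"

definition fmon :: "mtable \<Rightarrow> bool" where
  "fmon M = (case M of (m, e, mul) \<Rightarrow>
     e < m \<and> (\<forall>x<m. \<forall>y<m. mul x y < m)
     \<and> (\<forall>x<m. \<forall>y<m. \<forall>z<m. mul (mul x y) z = mul x (mul y z))
     \<and> (\<forall>x<m. mul e x = x \<and> mul x e = x))"

definition mcard :: "mtable \<Rightarrow> nat" where "mcard M = fst M"
definition munit :: "mtable \<Rightarrow> nat" where "munit M = fst (snd M)"
definition mmul :: "mtable \<Rightarrow> nat \<Rightarrow> nat \<Rightarrow> nat" where "mmul M = snd (snd M)"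

definition mhom :: "mtable \<Rightarrow> mtable \<Rightarrow> (nat \<Rightarrow> nat) \<Rightarrow> bool" where
  "mhom M N h \<longleftrightarrow> (\<forall>x<mcard M. h x < mcard N) \<and> h (munit M) = munit N
     \<and> (\<forall>x<mcard M. \<forall>y<mcard M. h (mmul M x y) = mmul N (h x) (h y))"

text \<open>A monoid variety in the sense of Eilenberg (pseudovariety): a class of finite monoids
  closed under submonoids, homomorphic images and finite direct products.\<close>
definition monoid_variety :: "(mtable \<Rightarrow> bool) \<Rightarrow> bool" where
  "monoid_variety V \<longleftrightarrow>
     (\<forall>M. V M \<longrightarrow> fmon M)
   \<and> V (1, 0, \<lambda>_ _. 0)
   \<and> (\<forall>M N h. V M \<and> fmon N \<and> mhom N M h \<and> inj_on h {..<mcard N} \<longrightarrow> V N)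
   \<and> (\<forall>M N h. V M \<and> fmon N \<and> mhom M N h \<and> h ` {..<mcard M} = {..<mcard N} \<longrightarrow> V N)
   \<and> (\<forall>M N P h1 h2. V M \<and> V N \<and> fmon P \<and> mhom P M h1 \<and> mhom P N h2
        \<and> bij_betw (\<lambda>x. (h1 x, h2 x)) {..<mcard P} ({..<mcard M} \<times> {..<mcard N}) \<longrightarrow> V P)"

definition enc_mtable :: "mtable \<Rightarrow> sexp" where
  "enc_mtable M = (case M of (m, e, mul) \<Rightarrow>
     Lst [Atom m, Atom e, Lst (map (\<lambda>i. natlist (map (\<lambda>j. mul i j) [0..<m])) [0..<m])])"

text \<open>States {0..<nq}, alphabet {0..<ns}, initial state q0, initial output iout,
  transitions delta as an association list (p,a) to (q,w), final states with terminal
  outputs fout as an association list.\<close>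
datatype dft = DFT (nq: nat) (ns: nat) (q0: nat) (iout: "nat list")
  (delta: "((nat \<times> nat) \<times> (nat \<times> nat list)) list") (fout: "(nat \<times> nat list) list")

definition wf_dft :: "dft \<Rightarrow> bool" where
  "wf_dft T \<longleftrightarrow> q0 T < nq T \<and> set (iout T) \<subseteq> {..<ns T}
     \<and> distinct (map fst (delta T)) \<and> distinct (map fst (fout T))
     \<and> (\<forall>((p,a),(q,w)) \<in> set (delta T). p < nq T \<and> a < ns T \<and> q < nq T \<and> set w \<subseteq> {..<ns T})
     \<and> (\<forall>(q,t) \<in> set (fout T). q < nq T \<and> set t \<subseteq> {..<ns T})"

fun run :: "dft \<Rightarrow> nat \<Rightarrow> nat list \<Rightarrow> (nat \<times> nat list) option" where
  "run T p [] = Some (p, [])"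
| "run T p (a # u) = (case map_of (delta T) (p, a) of None \<Rightarrow> None
     | Some (q, w) \<Rightarrow> map_option (\<lambda>(r, w'). (r, w @ w')) (run T q u))"

definition dft_fun :: "dft \<Rightarrow> nat list \<Rightarrow> nat list option" where
  "dft_fun T u = (case run T (q0 T) u of None \<Rightarrow> None
     | Some (q, w) \<Rightarrow> map_option (\<lambda>t. iout T @ w @ t) (map_of (fout T) q))"

definition words :: "dft \<Rightarrow> nat list set" where
  "words T = {u. set u \<subseteq> {..<ns T}}"

definition runrel :: "dft \<Rightarrow> nat list \<Rightarrow> (nat \<times> nat) set" where
  "runrel T u = {(p, q). p < nq T \<and> q < nq T \<and> (\<exists>w. run T p u = Some (q, w))}"

text \<open>Transition monoid: Sigma^* modulo equality of run relations, represented by the set of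
  run relations with relational composition as product (runrel (u v) = runrel u O runrel v).\<close>
definition trans_monoid :: "dft \<Rightarrow> (nat \<times> nat) set set" where
  "trans_monoid T = runrel T ` words T"

definition tm_in :: "(mtable \<Rightarrow> bool) \<Rightarrow> dft \<Rightarrow> bool" where
  "tm_in V T \<longleftrightarrow> (\<exists>M f. V M \<and> bij_betw f (trans_monoid T) {..<mcard M}
     \<and> f (runrel T []) = munit M
     \<and> (\<forall>r\<in>trans_monoid T. \<forall>s\<in>trans_monoid T. f (r O s) = mmul M (f r) (f s)))"

definition V_dft :: "(mtable \<Rightarrow> bool) \<Rightarrow> dft \<Rightarrow> bool" where
  "V_dft V T \<longleftrightarrow> wf_dft T \<and> tm_in V T"

definition V_definable :: "(mtable \<Rightarrow> bool) \<Rightarrow> dft \<Rightarrow> bool" where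
  "V_definable V T \<longleftrightarrow> (\<exists>T'. V_dft V T' \<and> ns T' = ns T
     \<and> (\<forall>u\<in>words T. dft_fun T' u = dft_fun T u))"

definition enc_dft :: "dft \<Rightarrow> sexp" where
  "enc_dft T = Lst [Atom (nq T), Atom (ns T), Atom (q0 T), natlist (iout T),
     Lst (map (\<lambda>((p,a),(q,w)). Lst [Atom p, Atom a, Atom q, natlist w]) (delta T)),
     Lst (map (\<lambda>(q,t). Lst [Atom q, natlist t]) (fout T))]"

end

theory Submission
  imports Defs
begin

text \<open>Call words \<open>u\<close> and \<open>v\<close> equivalent for \<open>f\<close> when the residuals \<open>\<lambda>z. f (u z)\<close> and
  \<open>\<lambda>z. f (v z)\<close> agree after removal of their longest common prefixes (Choffrut). A function
  computed by a DFT has finitely many classes, and they are the states of a complete DFT \<open>T'\<close> for \<open>f\<close>.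
  Words with different actions on the states of \<open>T'\<close> have different actions on the states of any DFT for \<open>f\<close>,
  so the transition monoid of \<open>T'\<close> is a quotient of that of every such DFT; hence \<open>f\<close> is
  \<open>V\<close>-definable iff the transition monoid of \<open>T'\<close> lies in \<open>V\<close>.

  The algorithm does not construct \<open>T'\<close> but searches for it, together with finite evidence that can be
  checked: a simulation proving that \<open>T'\<close> is equivalent to \<open>T\<close>, words representing the elements of the
  transition monoid, and words on which the residuals of different elements differ. It then
  applies the decision procedure for \<open>V\<close> to the multiplication table of the representatives.\<close>

section \<open>Computable functions\<close>

text \<open>The obstacle is the machine model: \<open>decides\<close> wants a \<open>recf\<close>
  term, so an explicit construction of the residual transducer would need a program and a
  termination bound for each of its steps. Checking a certificate needs only quantifiers over lists,
  and one \<open>Mn\<close> finds it; that a certificate exists is then pure mathematics, free to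
  use choice and maxima. The price is that soundness has to cover every valid certificate, since the
  one found need not contain the residual transducer. The procedure for \<open>V\<close> is known to
  halt only on codes of finite monoids. It therefore stays out of the search condition and runs
  once, on the table that a valid certificate yields. The residual transducer is complete because
  the nowhere defined residual is a class like any other. A competing DFT may block instead; a
  missing run then also has the nowhere defined residual, so equal run relations still give equal
  residuals. Left contexts enter because the monoid compares actions on all states, and states are
  reached by reading prefixes.\<close>

definition total_recursive :: "(nat \<Rightarrow> nat) \<Rightarrow> bool" where
  "total_recursive F \<longleftrightarrow> (\<exists>r. \<forall>n. eval_rf r [n] (F n))"

lemma eval_Proj0: "eval_rf (Proj 0) (x # xs) x"
  using ev_Proj[of 0 "x # xs"] by simp

lemma eval_Proj1: "eval_rf (Proj 1) (x # y # xs) y"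
  using ev_Proj[of 1 "x # y # xs"] by simp

lemma eval_Proj2: "eval_rf (Proj 2) (x # y # z # xs) z"
  using ev_Proj[of 2 "x # y # z # xs"] by simp

lemmas eval_Proj = eval_Proj0 eval_Proj1 eval_Proj1[simplified] eval_Proj2

lemma eval_Comp1: "eval_rf g xs y \<Longrightarrow> eval_rf f [y] z \<Longrightarrow> eval_rf (Comp f [g]) xs z"
  by (rule ev_Comp[of _ _ "[y]"]) auto

lemma eval_Comp2:
  "eval_rf g xs y \<Longrightarrow> eval_rf h xs y' \<Longrightarrow> eval_rf f [y, y'] z \<Longrightarrow> eval_rf (Comp f [g, h]) xs z"
  by (rule ev_Comp[of _ _ "[y, y']"]) auto

lemma eval_Prim:
  assumes "\<And>xs. eval_rf f xs0 (F 0)" "\<And>n. eval_rf g (n # F n # xs0) (F (Suc n))"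
  shows "eval_rf (Prim f g) (n # xs0) (F n)"
  by (induction n) (auto intro: ev_Prim0 ev_PrimS assms)

definition "rf_pred = Prim Zr (Proj 0)"
definition "rf_add = Prim (Proj 0) (Comp Sc [Proj 1])"
definition "rf_sub = Prim (Proj 0) (Comp rf_pred [Proj 1])"
definition "rf_tri = Prim Zr (Comp rf_add [Proj 1, Comp Sc [Proj 0]])"
definition "rf_pair = Comp rf_add [Comp rf_tri [Comp rf_add [Proj 0, Proj 1]], Proj 0]"
text \<open>The least \<open>n\<close> with \<open>z < triangle (Suc n)\<close>, that is, the
  diagonal of the Cantor pairing on which \<open>z\<close> lies. \<open>rf_sub\<close> on
  \<open>[a, b]\<close> is \<open>b - a\<close>, as its recursion consumes the first
  argument.\<close>

definition "rf_root = Mn (Comp rf_sub [Comp rf_tri [Comp Sc [Proj 0]], Comp Sc [Proj 1]])"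
definition "rf_fst = Comp rf_sub [Comp rf_tri [rf_root], Proj 0]"
definition "rf_snd = Comp rf_sub [rf_fst, rf_root]"

lemma eval_pred: "eval_rf rf_pred [n] (n - 1)"
  unfolding rf_pred_def
  by (rule eval_Prim[where F = "\<lambda>n. n - 1"]) (auto intro: ev_Z eval_Proj)

lemma eval_add: "eval_rf rf_add [m, n] (m + n)"
  unfolding rf_add_def
  by (rule eval_Prim[where F = "\<lambda>m. m + n"]) (auto intro!: eval_Proj eval_Comp1 ev_S)

lemma eval_sub: "eval_rf rf_sub [m, n] (n - m)"
  unfolding rf_sub_def
proof (rule eval_Prim[where F = "\<lambda>m. n - m"])
  fix m
  show "eval_rf (Comp rf_pred [Proj 1]) [m, n - m, n] (n - Suc m)"
    using eval_Comp1[OF eval_Proj1 eval_pred, of m "n - m" "[n]"] by simp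
qed (auto intro: eval_Proj)

lemma eval_tri: "eval_rf rf_tri [n] (triangle n)"
  unfolding rf_tri_def
  by (rule eval_Prim[where F = triangle])
     (auto intro!: ev_Z eval_Comp2 eval_Comp1 ev_S eval_Proj eval_add[of "triangle _" "Suc _", simplified])

lemma eval_pair: "eval_rf rf_pair [m, n] (prod_encode (m, n))"
  unfolding rf_pair_def prod_encode_def
  by (auto intro!: eval_Comp2 eval_Comp1 eval_Proj eval_add eval_tri)

definition tri_root :: "nat \<Rightarrow> nat" where
  "tri_root z = fst (prod_decode z) + snd (prod_decode z)"

lemma tri_root: "z = triangle (tri_root z) + fst (prod_decode z)"
  using prod_decode_inverse[of z]
  by (simp add: tri_root_def prod_encode_def split: prod.splits)

lemma eval_root: "eval_rf rf_root [z] (tri_root z)"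
  unfolding rf_root_def
proof (rule ev_Mn)
  let ?r = "Comp rf_sub [Comp rf_tri [Comp Sc [Proj 0]], Comp Sc [Proj 1]]"
  have ev: "eval_rf ?r [n, z] (Suc z - triangle (Suc n))" for n
    by (auto intro!: eval_Comp2 eval_Comp1 ev_S eval_Proj eval_sub eval_tri simp del: triangle_Suc)
  \<comment> \<open>The offset of \<open>z\<close> on its diagonal is
    \<open>fst (prod_decode z)\<close>, which is at most \<open>tri_root z\<close>; hence
    \<open>z\<close> lies below the next triangle number.\<close>
  have "Suc z - triangle (Suc (tri_root z)) = 0"
    using tri_root[of z] by (simp add: tri_root_def)
  then show "eval_rf ?r [tri_root z, z] 0"
    using ev[of "tri_root z"] by simp
  show "\<forall>m<tri_root z. \<exists>y>0. eval_rf ?r [m, z] y"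
  proof (intro allI impI)
    fix m assume "m < tri_root z"
    then have "Suc m \<le> tri_root z" by simp
    \<comment> \<open>Minimality: the diagonal following an earlier \<open>m\<close> starts at or
      before \<open>z\<close>.\<close>
    then have "triangle (Suc m) \<le> triangle (tri_root z)"
      by (rule lift_Suc_mono_le[of triangle, rotated]) simp
    then have "0 < Suc z - triangle (Suc m)" using tri_root[of z] by linarith
    then show "\<exists>y>0. eval_rf ?r [m, z] y" using ev by blast
  qed
qed

lemma eval_fst: "eval_rf rf_fst [z] (fst (prod_decode z))"
proof -
  have "fst (prod_decode z) = z - triangle (tri_root z)" using tri_root[of z] by linarith
  then show ?thesis unfolding rf_fst_def
    by (auto intro!: eval_Comp2 eval_Comp1 eval_Proj eval_sub eval_tri eval_root)
qed

lemma eval_snd: "eval_rf rf_snd [z] (snd (prod_decode z))"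
proof -
  have "snd (prod_decode z) = tri_root z - fst (prod_decode z)" by (simp add: tri_root_def)
  then show ?thesis unfolding rf_snd_def
    by (auto intro!: eval_Comp2 eval_fst eval_sub eval_root)
qed

lemma total_recursive_id: "total_recursive (\<lambda>n. n)"
  unfolding total_recursive_def using eval_Proj0 by blast

lemma total_recursive_comp:
  "total_recursive F \<Longrightarrow> total_recursive G \<Longrightarrow> total_recursive (\<lambda>n. F (G n))"
  unfolding total_recursive_def using eval_Comp1 by blast

lemma total_recursive_Suc: "total_recursive F \<Longrightarrow> total_recursive (\<lambda>n. Suc (F n))"
  unfolding total_recursive_def using eval_Comp1 ev_S by blast

lemma total_recursive_const: "total_recursive (\<lambda>_. c)"
proof (induction c)
  case 0
  show ?case unfolding total_recursive_def using ev_Z by blast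
qed (rule total_recursive_Suc)

lemma total_recursive_pair:
  "total_recursive F \<Longrightarrow> total_recursive G \<Longrightarrow> total_recursive (\<lambda>n. prod_encode (F n, G n))"
  unfolding total_recursive_def using eval_Comp2 eval_pair by blast

lemma total_recursive_fst: "total_recursive F \<Longrightarrow> total_recursive (\<lambda>n. fst (prod_decode (F n)))"
  unfolding total_recursive_def using eval_Comp1 eval_fst by blast

lemma total_recursive_snd: "total_recursive F \<Longrightarrow> total_recursive (\<lambda>n. snd (prod_decode (F n)))"
  unfolding total_recursive_def using eval_Comp1 eval_snd by blast

text \<open>The step receives the whole input \<open>z\<close> next to counter and accumulator, so
  that loop bodies can refer to surrounding variables once these are packed into
  \<open>z\<close>.\<close>

lemma total_recursive_rec_nat:
  assumes "total_recursive F" "total_recursive G" "total_recursive H"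
  shows "total_recursive (\<lambda>z. rec_nat (F z) (\<lambda>n s. G (prod_encode (z, prod_encode (n, s)))) (H z))"
proof -
  obtain f g h where f: "\<And>n. eval_rf f [n] (F n)" and g: "\<And>n. eval_rf g [n] (G n)"
    and h: "\<And>n. eval_rf h [n] (H n)"
    using assms unfolding total_recursive_def by blast
  let ?g = "Comp g [Comp rf_pair [Proj 2, Comp rf_pair [Proj 0, Proj 1]]]"
  let ?R = "\<lambda>z. rec_nat (F z) (\<lambda>n s. G (prod_encode (z, prod_encode (n, s))))"
  have "eval_rf (Prim f ?g) [n, z] (?R z n)" for n z
    by (rule eval_Prim[where F = "?R z"]) (auto intro!: eval_Comp1 eval_Comp2 eval_Proj eval_pair f g)
  then have "eval_rf (Comp (Prim f ?g) [h, Proj 0]) [z] (?R z (H z))" for z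
    by (auto intro!: eval_Comp2 h eval_Proj)
  then show ?thesis unfolding total_recursive_def by blast
qed

section \<open>Goedel numbers of data types\<close>

class coded =
  fixes gn :: "'a \<Rightarrow> nat"
  assumes gn_inject [simp]: "gn x = gn y \<longleftrightarrow> x = y"

instantiation nat :: coded
begin
definition gn_nat :: "nat \<Rightarrow> nat" where [simp]: "gn_nat n = n"
instance by standard simp
end

instantiation bool :: coded
begin
definition gn_bool :: "bool \<Rightarrow> nat" where "gn_bool b = (if b then 1 else 0)"
instance by standard (simp add: gn_bool_def)
end

instantiation prod :: (coded, coded) coded
begin
definition gn_prod :: "'a \<times> 'b \<Rightarrow> nat" where "gn_prod p = prod_encode (gn (fst p), gn (snd p))"
instance by standard (auto simp: gn_prod_def prod_eq_iff)
end

instantiation list :: (coded) coded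
begin
definition gn_list :: "'a list \<Rightarrow> nat" where "gn_list xs = list_encode (map gn xs)"
instance
proof
  fix xs ys :: "'a list"
  have "inj (gn :: 'a \<Rightarrow> nat)" by (auto intro: injI)
  then show "gn xs = gn ys \<longleftrightarrow> xs = ys"
    by (simp add: gn_list_def list_encode_eq)
qed
end

instantiation option :: (coded) coded
begin
definition gn_option :: "'a option \<Rightarrow> nat" where
  "gn_option x = (case x of None \<Rightarrow> 0 | Some y \<Rightarrow> Suc (gn y))"
instance by standard (simp add: gn_option_def split: option.splits)
end

instantiation dft :: coded
begin
definition gn_dft :: "dft \<Rightarrow> nat" where
  "gn_dft T = gn (nq T, ns T, q0 T, iout T, delta T, fout T)"
instance by standard (auto simp: gn_dft_def intro: dft.expand)
end

lemma gn_Nil: "gn [] = 0"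
  and gn_Cons: "gn (x # xs) = Suc (prod_encode (gn x, gn xs))"
  by (simp_all add: gn_list_def)

text \<open>Surjectivity is for the search: \<open>Mn\<close> ranges over all numbers, so each
  number has to be the code of some candidate. It is shown for the types that make up a
  certificate.\<close>

lemma surj_gn_nat: "surj (gn :: nat \<Rightarrow> nat)"
  by (auto simp: surj_def)

lemma surj_gn_prod:
  assumes "surj (gn :: 'a::coded \<Rightarrow> nat)" "surj (gn :: 'b::coded \<Rightarrow> nat)"
  shows "surj (gn :: 'a \<times> 'b \<Rightarrow> nat)"
  unfolding surj_def
proof
  fix n
  obtain a b where "prod_decode n = (gn (a::'a), gn (b::'b))"
    using assms by (metis surjD surj_pair)
  then have "n = gn (a, b)" by (metis gn_prod_def fst_conv snd_conv prod_decode_inverse)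
  then show "\<exists>x. n = gn (x :: 'a \<times> 'b)" by blast
qed

lemma surj_gn_list:
  assumes "surj (gn :: 'a::coded \<Rightarrow> nat)"
  shows "surj (gn :: 'a list \<Rightarrow> nat)"
  unfolding surj_def
proof
  fix n
  have "map (gn :: 'a \<Rightarrow> nat) (map (inv gn) (list_decode n)) = list_decode n"
    using assms by (simp add: surj_f_inv_f map_idI)
  then have "n = gn (map (inv (gn :: 'a \<Rightarrow> nat)) (list_decode n))"
    by (simp only: gn_list_def list_decode_inverse)
  then show "\<exists>x. n = gn (x :: 'a list)" by blast
qed

lemma surj_gn_dft: "surj (gn :: dft \<Rightarrow> nat)"
  unfolding surj_def
proof
  fix n
  have "surj (gn :: nat \<times> nat \<times> nat \<times> nat list \<times> ((nat \<times> nat) \<times> (nat \<times> nat list)) list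
      \<times> (nat \<times> nat list) list \<Rightarrow> nat)"
    by (intro surj_gn_prod surj_gn_list surj_gn_nat)
  then obtain t :: "nat \<times> nat \<times> nat \<times> nat list \<times> ((nat \<times> nat) \<times> (nat \<times> nat list)) list
      \<times> (nat \<times> nat list) list" where t: "n = gn t"
    by (meson surjD)
  obtain a b c d e f where "t = (a, b, c, d, e, f)" by (cases t)
  then have "n = gn (DFT a b c d e f)" by (simp add: gn_dft_def t)
  then show "\<exists>T. n = gn (T :: dft)" by blast
qed

section \<open>Computability of functions between coded types\<close>

definition computable :: "('a::coded \<Rightarrow> 'b::coded) \<Rightarrow> bool" where
  "computable f \<longleftrightarrow> (\<exists>F. total_recursive F \<and> (\<forall>x. F (gn x) = gn (f x)))"

lemma computableI: "total_recursive F \<Longrightarrow> (\<And>x. F (gn x) = gn (f x)) \<Longrightarrow> computable f"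
  unfolding computable_def by blast

lemma computableE:
  assumes "computable f" obtains F where "total_recursive F" "\<And>x. F (gn x) = gn (f x)"
  using assms unfolding computable_def by blast

text \<open>The rules speak of a term with a context variable \<open>x\<close>, not of a bare
  function, and a body under binders is judged with its bound variables paired to the context. Thus
  \<open>intro comp_intros\<close> acts as a compiler directed by the syntax of the term.\<close>

named_theorems comp_intros

lemma computable_id [comp_intros]: "computable (\<lambda>x. x)"
  by (rule computableI[OF total_recursive_id]) simp

lemma computable_const [comp_intros]: "computable (\<lambda>_. c)"
  by (rule computableI[OF total_recursive_const]) simp

lemma computable_comp: "computable g \<Longrightarrow> computable f \<Longrightarrow> computable (\<lambda>x. g (f x))"
  by (elim computableE) (rule computableI, erule (1) total_recursive_comp, simp)

lemma computable_Pair [comp_intros]: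
  "computable f \<Longrightarrow> computable g \<Longrightarrow> computable (\<lambda>x. (f x, g x))"
  by (elim computableE) (rule computableI, erule (1) total_recursive_pair, simp add: gn_prod_def)

lemma computable_fst [comp_intros]: "computable f \<Longrightarrow> computable (\<lambda>x. fst (f x))"
  by (elim computableE) (rule computableI[OF total_recursive_fst], auto simp: gn_prod_def)

lemma computable_snd [comp_intros]: "computable f \<Longrightarrow> computable (\<lambda>x. snd (f x))"
  by (elim computableE) (rule computableI[OF total_recursive_snd], auto simp: gn_prod_def)

lemma computable_Suc [comp_intros]: "computable f \<Longrightarrow> computable (\<lambda>x. Suc (f x))"
  by (elim computableE) (rule computableI[OF total_recursive_Suc], auto)

lemma computable_gn: "computable f \<Longrightarrow> computable (\<lambda>x. gn (f x))"
  unfolding computable_def by simp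

lemma computable_rec_nat [comp_intros]:
  assumes "computable f" "computable (\<lambda>z. g (fst z) (fst (snd z)) (snd (snd z)))" "computable h"
  shows "computable (\<lambda>x. rec_nat (f x) (g x) (h x))"
proof -
  obtain F G H where tr: "total_recursive F" "total_recursive G" "total_recursive H"
    and F: "\<And>x. F (gn x) = gn (f x)" and H: "\<And>x. H (gn x) = gn (h x)"
    and G: "\<And>z. G (gn z) = gn (g (fst z) (fst (snd z)) (snd (snd z)))"
    using assms unfolding computable_def by blast
  have G': "G (prod_encode (gn x, prod_encode (n, gn s))) = gn (g x n s)" for x n s
    using G[of "(x, n, s)"] by (simp add: gn_prod_def)
  have "rec_nat (F (gn x)) (\<lambda>n s. G (prod_encode (gn x, prod_encode (n, s)))) n = gn (rec_nat (f x) (g x) n)" for x n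
    by (induction n) (auto simp: F G')
  then show ?thesis
    by (intro computableI[OF total_recursive_rec_nat[OF tr]]) (simp add: H)
qed

lemma computable_case_prod [comp_intros]:
  "computable (\<lambda>x. g x (fst (p x)) (snd (p x))) \<Longrightarrow> computable (\<lambda>x. case_prod (g x) (p x))"
  by (simp add: split_beta)

lemma computable_case_prod_app [comp_intros]:
  "computable (\<lambda>x. g x (fst (p x)) (snd (p x)) (v x)) \<Longrightarrow> computable (\<lambda>x. case_prod (g x) (p x) (v x))"
  by (simp add: split_beta)

text \<open>Truth values have the codes 0 and 1, so a conditional is a recursion of at most one
  round.\<close>

lemma computable_if [comp_intros]:
  assumes "computable b" "computable f" "computable g"
  shows "computable (\<lambda>x. if b x then f x else g x)"
proof -
  have "computable (\<lambda>x. rec_nat (g x) (\<lambda>n s. f x) (gn (b x)))"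
    by (intro comp_intros computable_gn assms computable_comp[OF assms(2)])
  moreover have "(\<lambda>x. rec_nat (g x) (\<lambda>n s. f x) (gn (b x))) = (\<lambda>x. if b x then f x else g x)"
    by (auto simp: gn_bool_def)
  ultimately show ?thesis by simp
qed

lemma computable_not [comp_intros]: "computable P \<Longrightarrow> computable (\<lambda>x. \<not> P x)"
  using computable_if[of P "\<lambda>_. False" "\<lambda>_. True"] by (simp add: computable_const if_bool_eq_disj)

lemma computable_conj [comp_intros]:
  "computable P \<Longrightarrow> computable Q \<Longrightarrow> computable (\<lambda>x. P x \<and> Q x)"
  using computable_if[of P Q "\<lambda>_. False"] by (simp add: computable_const if_bool_eq_disj)

lemma computable_disj [comp_intros]:
  "computable P \<Longrightarrow> computable Q \<Longrightarrow> computable (\<lambda>x. P x \<or> Q x)"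
  using computable_not[OF computable_conj[OF computable_not computable_not], of P Q] by simp

lemma computable_imp [comp_intros]:
  "computable P \<Longrightarrow> computable Q \<Longrightarrow> computable (\<lambda>x. P x \<longrightarrow> Q x)"
  unfolding imp_conv_disj by (intro comp_intros)

lemma computable_pred: "computable f \<Longrightarrow> computable (\<lambda>x. f x - 1 :: nat)"
proof -
  assume f: "computable f"
  have "rec_nat 0 (\<lambda>n _. n) n = n - 1" for n by (cases n) auto
  moreover have "computable (\<lambda>x. rec_nat 0 (\<lambda>n _. n) (f x))"
    by (intro comp_intros f)
  ultimately show ?thesis by simp
qed

lemma computable_diff [comp_intros]:
  assumes "computable f" "computable g" shows "computable (\<lambda>x. f x - g x :: nat)"
proof -
  have "rec_nat m (\<lambda>_ s. s - 1) n = m - n" for m n :: nat by (induction n) auto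
  moreover have "computable (\<lambda>x. rec_nat (f x) (\<lambda>_ s. s - 1) (g x))"
    by (intro comp_intros computable_pred assms)
  ultimately show ?thesis by simp
qed

lemma computable_eq0: "computable f \<Longrightarrow> computable (\<lambda>x. f x = (0::nat))"
proof -
  assume f: "computable f"
  have "rec_nat True (\<lambda>_ _. False) n \<longleftrightarrow> n = 0" for n by (cases n) auto
  moreover have "computable (\<lambda>x. rec_nat True (\<lambda>_ _. False) (f x))"
    by (intro comp_intros f)
  ultimately show ?thesis by simp
qed

lemma computable_le [comp_intros]:
  assumes "computable f" "computable g" shows "computable (\<lambda>x. f x \<le> (g x :: nat))"
  using computable_eq0[OF computable_diff[OF assms]] by simp

lemma computable_less [comp_intros]:
  assumes "computable f" "computable g" shows "computable (\<lambda>x. f x < (g x :: nat))"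
  using computable_le[OF computable_Suc assms(2), OF assms(1)] by (simp add: Suc_le_eq)

text \<open>Codes are injective, so equality at any coded type amounts to two comparisons of
  numbers.\<close>

lemma computable_eq [comp_intros]:
  assumes "computable f" "computable g" shows "computable (\<lambda>x. f x = g x)"
proof -
  have "computable (\<lambda>x. gn (f x) \<le> gn (g x) \<and> gn (g x) \<le> gn (f x))"
    by (intro comp_intros computable_gn assms)
  then show ?thesis by (simp flip: order_eq_iff)
qed

lemma computable_Cons [comp_intros]:
  "computable f \<Longrightarrow> computable g \<Longrightarrow> computable (\<lambda>x. f x # g x)"
  by (elim computableE)
     (rule computableI, rule total_recursive_Suc, erule (1) total_recursive_pair, simp add: gn_Cons)

text \<open>Lists and options both code the empty case by 0 and the other case by a successor; this
  case distinction on raw codes serves both.\<close>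

lemma total_recursive_if0:
  assumes "total_recursive F" "total_recursive G" "total_recursive H"
  shows "total_recursive (\<lambda>n. if H n = 0 then F n else G n)"
proof -
  have "rec_nat (F z) (\<lambda>n s. G (fst (prod_decode (prod_encode (z, prod_encode (n, s)))))) n
      = (if n = 0 then F z else G z)" for n z by (cases n) auto
  moreover have "total_recursive (\<lambda>n. G (fst (prod_decode n)))"
    using total_recursive_comp[OF assms(2) total_recursive_fst[OF total_recursive_id]] by simp
  ultimately show ?thesis
    using total_recursive_rec_nat[OF assms(1) _ assms(3), of "\<lambda>n. G (fst (prod_decode n))"] by simp
qed

lemma total_recursive_pred: "total_recursive F \<Longrightarrow> total_recursive (\<lambda>n. F n - 1)"
  unfolding total_recursive_def using eval_Comp1 eval_pred by blast

lemma computable_case_list [comp_intros]: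
  assumes "computable l" "computable f" "computable (\<lambda>z. g (fst z) (fst (snd z)) (snd (snd z)))"
  shows "computable (\<lambda>x. case_list (f x) (g x) (l x))"
proof -
  obtain F G L where tr: "total_recursive F" "total_recursive G" "total_recursive L"
    and F: "\<And>x. F (gn x) = gn (f x)" and L: "\<And>x. L (gn x) = gn (l x)"
    and G: "\<And>z. G (gn z) = gn (g (fst z) (fst (snd z)) (snd (snd z)))"
    using assms unfolding computable_def by blast
  have G': "G (prod_encode (gn x, prod_encode (gn y, gn s))) = gn (g x y s)" for x y s
    using G[of "(x, y, s)"] by (simp add: gn_prod_def)
  \<comment> \<open>The code of \<open>y # ys\<close> minus one is the code of the pair
    \<open>(y, ys)\<close>; paired with \<open>n\<close> it is already the triple that
    \<open>G\<close> expects.\<close>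
  let ?C = "\<lambda>n. if L n = 0 then F n else G (prod_encode (n, L n - 1))"
  have "total_recursive ?C"
    by (intro total_recursive_if0 total_recursive_comp[OF tr(2)] total_recursive_pair
        total_recursive_id total_recursive_pred tr)
  moreover have "?C (gn x) = gn (case_list (f x) (g x) (l x))" for x
    by (cases "l x") (auto simp: F L G' gn_Nil gn_Cons)
  ultimately show ?thesis by (rule computableI)
qed

lemma computable_Some [comp_intros]: "computable f \<Longrightarrow> computable (\<lambda>x. Some (f x))"
  by (elim computableE) (rule computableI[OF total_recursive_Suc], auto simp: gn_option_def)

lemma computable_case_option [comp_intros]:
  assumes "computable l" "computable f" "computable (\<lambda>z. g (fst z) (snd z))"
  shows "computable (\<lambda>x. case_option (f x) (g x) (l x))"
proof -
  obtain F G L where tr: "total_recursive F" "total_recursive G" "total_recursive L"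
    and F: "\<And>x. F (gn x) = gn (f x)" and L: "\<And>x. L (gn x) = gn (l x)"
    and G: "\<And>z. G (gn z) = gn (g (fst z) (snd z))"
    using assms unfolding computable_def by blast
  have G': "G (prod_encode (gn x, gn y)) = gn (g x y)" for x y
    using G[of "(x, y)"] by (simp add: gn_prod_def)
  let ?C = "\<lambda>n. if L n = 0 then F n else G (prod_encode (n, L n - 1))"
  have "total_recursive ?C"
    by (intro total_recursive_if0 total_recursive_comp[OF tr(2)] total_recursive_pair
        total_recursive_id total_recursive_pred tr)
  moreover have "?C (gn x) = gn (case_option (f x) (g x) (l x))" for x
    by (cases "l x") (auto simp: F L G' gn_option_def)
  ultimately show ?thesis by (rule computableI)
qed

lemma computable_map_option [comp_intros]:
  assumes "computable (\<lambda>z. g (fst z) (snd z))" "computable l"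
  shows "computable (\<lambda>x. map_option (g x) (l x))"
  unfolding option.map_sel map_option_case
  by (intro comp_intros assms)

lemma length_le_gn: "length xs \<le> gn xs"
  by (induction xs)
     (auto simp: gn_Cons intro: order_trans[OF _ le_prod_encode_2])

text \<open>Iterating the step that consumes one list element as many times as the code of the list,
  which exceeds its length.\<close>
lemma computable_fold [comp_intros]:
  assumes g: "computable (\<lambda>z. g (fst z) (fst (snd z)) (snd (snd z)))"
    and l: "computable l" and i: "computable i"
  shows "computable (\<lambda>x. fold (g x) (l x) (i x))"
proof -
  \<comment> \<open>On the empty list the state is returned unchanged, so surplus rounds do no
    harm.\<close>
  let ?step = "\<lambda>x (n::nat) p. case_list p (\<lambda>y ys. (g x y (fst p), ys)) (snd p)"
  let ?it = "\<lambda>x. rec_nat (i x, l x) (?step x) (gn (l x))"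
  have "computable (\<lambda>z. g (fst (fst z)) (fst (snd z)) (fst (snd (snd (fst z)))))"
    by (rule computable_comp[OF g, of "\<lambda>z. (fst (fst z), fst (snd z), fst (snd (snd (fst z))))", simplified])
       (intro comp_intros)
  then have c: "computable (\<lambda>x. fst (?it x))"
    by (intro comp_intros computable_gn i l)
  have more: "rec_nat (i x, xs) (?step x) k = (fold (g x) xs (i x), [])" if "length xs \<le> k" for x xs k
  proof -
    have "rec_nat (i x, xs) (?step x) k = (fold (g x) (take k xs) (i x), drop k xs)" for k
    proof (induction k)
      case (Suc k)
      show ?case
      proof (cases "k < length xs")
        case True
        then show ?thesis using Suc
          by (simp add: take_Suc_conv_app_nth flip: Cons_nth_drop_Suc)
      qed (use Suc in simp)
    qed simp
    with that show ?thesis by simp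
  qed
  have "fst (?it x) = fold (g x) (l x) (i x)" for x
    by (simp add: more length_le_gn)
  with c show ?thesis by simp
qed

lemma computable_rev [comp_intros]: "computable f \<Longrightarrow> computable (\<lambda>x. rev (f x))"
  unfolding rev_conv_fold by (intro comp_intros)

lemma computable_append [comp_intros]:
  "computable f \<Longrightarrow> computable g \<Longrightarrow> computable (\<lambda>x. f x @ g x)"
proof -
  assume "computable f" "computable g"
  then have "computable (\<lambda>x. fold Cons (rev (f x)) (g x))" by (intro comp_intros)
  then show ?thesis by (simp add: fold_Cons_rev)
qed

lemma computable_foldr [comp_intros]:
  assumes "computable (\<lambda>z. g (fst z) (fst (snd z)) (snd (snd z)))" "computable l" "computable i"
  shows "computable (\<lambda>x. foldr (g x) (l x) (i x))"
  unfolding foldr_conv_fold by (intro comp_intros assms)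

lemma computable_map [comp_intros]:
  assumes g: "computable (\<lambda>z. g (fst z) (snd z))" and l: "computable l"
  shows "computable (\<lambda>x. map (g x) (l x))"
proof -
  have "computable (\<lambda>z. g (fst z) (fst (snd z)))"
    by (rule computable_comp[OF g, of "\<lambda>z. (fst z, fst (snd z))", simplified]) (intro comp_intros)
  then have "computable (\<lambda>x. foldr (\<lambda>y s. g x y # s) (l x) [])"
    by (intro comp_intros l)
  moreover have "foldr (\<lambda>y s. g x y # s) ys [] = map (g x) ys" for x ys
    by (induction ys) auto
  ultimately show ?thesis by simp
qed

lemma computable_ball [comp_intros]:
  assumes g: "computable (\<lambda>z. P (fst z) (snd z))" and l: "computable l"
  shows "computable (\<lambda>x. \<forall>y\<in>set (l x). P x y)"
proof -
  have "computable (\<lambda>z. P (fst z) (fst (snd z)))"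
    by (rule computable_comp[OF g, of "\<lambda>z. (fst z, fst (snd z))", simplified]) (intro comp_intros)
  then have "computable (\<lambda>x. foldr (\<lambda>y s. P x y \<and> s) (l x) True)"
    by (intro comp_intros l)
  moreover have "foldr (\<lambda>y s. P x y \<and> s) ys True \<longleftrightarrow> (\<forall>y\<in>set ys. P x y)" for x ys
    by (induction ys) auto
  ultimately show ?thesis by simp
qed

lemma computable_bex [comp_intros]:
  assumes g: "computable (\<lambda>z. P (fst z) (snd z))" and l: "computable l"
  shows "computable (\<lambda>x. \<exists>y\<in>set (l x). P x y)"
  using computable_not[OF computable_ball[OF computable_not[OF g] l]] by simp

lemma computable_upt [comp_intros]:
  assumes "computable f" shows "computable (\<lambda>x. [0..<f x])"
proof -
  have "rec_nat [] (\<lambda>n s. s @ [n]) n = [0..<n]" for n by (induction n) auto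
  moreover have "computable (\<lambda>x. rec_nat [] (\<lambda>n s. s @ [n]) (f x))"
    by (intro comp_intros assms)
  ultimately show ?thesis by simp
qed

lemma computable_length [comp_intros]:
  assumes "computable f" shows "computable (\<lambda>x. length (f x))"
proof -
  have "foldr (\<lambda>_ s. Suc s) xs 0 = length xs" for xs :: "'b list" by (induction xs) auto
  moreover have "computable (\<lambda>x. foldr (\<lambda>_ s. Suc s) (f x) 0)"
    by (intro comp_intros assms)
  ultimately show ?thesis by simp
qed

lemma computable_member [comp_intros]:
  assumes "computable f" "computable l" shows "computable (\<lambda>x. f x \<in> set (l x))"
proof -
  have "computable (\<lambda>z. snd z = f (fst z))"
    by (intro comp_intros computable_comp[OF assms(1)])
  from computable_bex[OF this assms(2)] show ?thesis by auto
qed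

section \<open>Residuals up to left factors\<close>

definition prepend :: "'a list \<Rightarrow> ('z \<Rightarrow> 'a list option) \<Rightarrow> 'z \<Rightarrow> 'a list option" where
  "prepend w h = (\<lambda>z. map_option ((@) w) (h z))"

text \<open>Phrased through factorisations of \<open>h\<close>, the form in which maximality is
  used. The nowhere defined function has every word as a left factor, hence the default
  \<open>[]\<close>.\<close>

definition lcp :: "('z \<Rightarrow> 'a list option) \<Rightarrow> 'a list" where
  "lcp h = (if \<forall>z. h z = None then [] else arg_max length (\<lambda>w. \<exists>k. h = prepend w k))"

definition strip :: "('z \<Rightarrow> 'a list option) \<Rightarrow> 'z \<Rightarrow> 'a list option" where
  "strip h = (\<lambda>z. map_option (drop (length (lcp h))) (h z))"

lemma prepend_Nil [simp]: "prepend [] h = h"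
  by (simp add: prepend_def fun_eq_iff option.map_ident map_option_case split: option.splits)

lemma prepend_prepend [simp]: "prepend v (prepend w h) = prepend (v @ w) h"
  by (simp add: prepend_def fun_eq_iff map_option_case split: option.splits)

lemma prepend_None_iff [simp]: "prepend w h z = None \<longleftrightarrow> h z = None"
  by (simp add: prepend_def)

lemma lcp_None: "\<forall>z. h z = None \<Longrightarrow> lcp h = []"
  by (simp add: lcp_def)

lemma prepend_same_length:
  assumes "prepend v h = prepend w k" "length v = length w" "h z \<noteq> None"
  shows "v = w"
  using fun_cong[OF assms(1), of z] assms(2,3) by (cases "k z") (auto simp: prepend_def)

lemma lcp_props:
  assumes "h z \<noteq> None"
  shows "\<exists>k. h = prepend (lcp h) k" "h = prepend w k \<Longrightarrow> length w \<le> length (lcp h)"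
proof -
  obtain r where r: "h z = Some r" using assms by blast
  let ?P = "\<lambda>w. \<exists>k. h = prepend w k"
  have "?P []" by simp
  \<comment> \<open>Every left factor is a prefix of the single value \<open>r\<close>, which bounds
    the lengths for \<open>arg_max\<close>.\<close>
  moreover have "\<forall>w. ?P w \<longrightarrow> length w < Suc (length r)"
  proof (intro allI impI)
    fix w assume "?P w"
    then show "length w < Suc (length r)" using r by (auto simp: prepend_def)
  qed
  ultimately have "?P (arg_max length ?P) \<and> (\<forall>w. ?P w \<longrightarrow> length w \<le> length (arg_max length ?P))"
    by (rule arg_max_nat_lemma)
  moreover have "lcp h = arg_max length ?P" using assms unfolding lcp_def by meson
  ultimately have P: "?P (lcp h)" and max: "\<forall>w. ?P w \<longrightarrow> length w \<le> length (lcp h)" by simp_all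
  show "\<exists>k. h = prepend (lcp h) k" by (rule P)
  show "h = prepend w k \<Longrightarrow> length w \<le> length (lcp h)" by (rule max[rule_format, OF exI])
qed

lemma prepend_lcp_strip: "prepend (lcp h) (strip h) = h"
proof (cases "\<forall>z. h z = None")
  case False
  then obtain z where "h z \<noteq> None" by blast
  from lcp_props(1)[of h, OF this] obtain k where k: "h = prepend (lcp h) k" ..
  have hz: "h z = map_option ((@) (lcp h)) (k z)" for z
    using fun_cong[OF k, of z] unfolding prepend_def .
  show ?thesis
  proof
    fix z
    show "prepend (lcp h) (strip h) z = h z"
      by (cases "k z") (simp_all add: prepend_def strip_def hz[of z])
  qed
next
  case True
  show ?thesis
  proof
    fix z
    have "h z = None" using True ..
    then show "prepend (lcp h) (strip h) z = h z" by (simp add: prepend_def strip_def)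
  qed
qed

text \<open>Lengths are compared in both directions. \<open>w @ lcp h\<close> is a left factor of
  \<open>prepend w h\<close>; conversely \<open>lcp (prepend w h)\<close> extends \<open>w\<close>,
  and cancelling \<open>w\<close> leaves a left factor of \<open>h\<close>. At a point of the domain
  a left factor is determined by its length.\<close>

lemma lcp_prepend:
  assumes "h z \<noteq> None" shows "lcp (prepend w h) = w @ lcp h"
proof -
  let ?h = "prepend w h"
  obtain r where r: "h z = Some r" using assms by blast
  have "?h z \<noteq> None" using assms by simp
  from lcp_props(1)[of ?h, OF this] obtain k where k: "?h = prepend (lcp ?h) k" ..
  have eq: "prepend w h = prepend (w @ lcp h) (strip h)"
    using prepend_prepend[of w "lcp h" "strip h"] by (simp only: prepend_lcp_strip)
  then have len: "length (w @ lcp h) \<le> length (lcp ?h)"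
    by (rule lcp_props(2)[of ?h z, rotated]) (simp add: assms)
  have hk: "map_option ((@) w) (h y) = map_option ((@) (lcp ?h)) (k y)" for y
    using fun_cong[OF k, of y] by (simp add: prepend_def)
  obtain s where "w @ r = lcp ?h @ s" using hk[of z] r by (cases "k z") auto
  \<comment> \<open>Both are prefixes of one word, and \<open>lcp ?h\<close> is at least as long as
    \<open>w\<close>.\<close>
  then have "\<exists>v. lcp ?h = w @ v"
    using len by (subst (asm) append_eq_append_conv2) (metis append_Nil2 length_append le_add1
      length_0_conv le_antisym add_le_same_cancel1 le_trans le_zero_eq)
  then obtain v where v: "lcp ?h = w @ v" ..
  have "h = prepend v k"
  proof
    fix y
    show "h y = prepend v k y"
      using hk[of y] unfolding v by (cases "h y"; cases "k y") (auto simp: prepend_def)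
  qed
  then have "length v \<le> length (lcp h)" by (rule lcp_props(2)[of h, OF assms])
  then have "length (lcp ?h) = length (w @ lcp h)" using v len by simp
  moreover have "prepend (lcp ?h) k = prepend (w @ lcp h) (strip h)" using k eq by simp
  moreover have "k z \<noteq> None" using hk[of z] r by (cases "k z") auto
  ultimately show ?thesis using prepend_same_length[of "lcp ?h" k "w @ lcp h" "strip h" z] by simp
qed

lemma strip_prepend: "strip (prepend w h) = strip h"
proof (cases "\<forall>z. h z = None")
  case True
  then show ?thesis by (auto simp: strip_def prepend_def)
next
  case False
  then obtain z where "h z \<noteq> None" by blast
  then have "lcp (prepend w h) = w @ lcp h" by (rule lcp_prepend)
  then show ?thesis
    by (simp add: strip_def prepend_def option.map_comp comp_def fun_eq_iff)
qed

lemma strip_None_iff [simp]: "strip h z = None \<longleftrightarrow> h z = None"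
  by (simp add: strip_def)

text \<open>With this form no longest common prefix has to be computed: to tell two residuals apart
  it is enough to refute all pairs of left factors.\<close>

lemma strip_eq_iff: "strip h = strip k \<longleftrightarrow> (\<exists>v w g. h = prepend v g \<and> k = prepend w g)"
  by (metis prepend_lcp_strip strip_prepend)

definition residual :: "('a list \<Rightarrow> 'b list option) \<Rightarrow> 'a list \<Rightarrow> 'a list \<Rightarrow> 'b list option" where
  "residual f u = strip (\<lambda>z. f (u @ z))"

text \<open>The residual of a word determines that of every extension, so reading a letter is well
  defined on residuals and they can serve as states.\<close>

lemma residual_append: "residual f (u @ v) = strip (\<lambda>z. residual f u (v @ z))"
proof -
  have "(\<lambda>z. f ((u @ v) @ z)) = prepend (lcp (\<lambda>z. f (u @ z))) (\<lambda>z. residual f u (v @ z))"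
    using fun_cong[OF prepend_lcp_strip[of "\<lambda>z. f (u @ z)"]]
    by (auto simp: residual_def prepend_def fun_eq_iff)
  then show ?thesis by (metis residual_def strip_prepend)
qed

section \<open>Runs, outputs and residuals of a transducer\<close>

fun out_from :: "dft \<Rightarrow> nat \<Rightarrow> nat list \<Rightarrow> nat list option" where
  "out_from T p [] = map_of (fout T) p"
| "out_from T p (a # u) = (case map_of (delta T) (p, a) of None \<Rightarrow> None
     | Some (q, w) \<Rightarrow> map_option ((@) w) (out_from T q u))"

lemma run_append:
  "run T p (u @ v) = (case run T p u of None \<Rightarrow> None
     | Some (q, w) \<Rightarrow> map_option (\<lambda>(r, w'). (r, w @ w')) (run T q v))"
proof (induction u arbitrary: p)
  case Nil
  then show ?case by (cases "run T p v") auto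
next
  case (Cons a u)
  show ?case
  proof (cases "map_of (delta T) (p, a)")
    case (Some qw)
    then show ?thesis using Cons[of "fst qw"]
      by (cases qw; cases "run T (fst qw) u") (auto simp: option.map_comp comp_def split_def)
  qed simp
qed

lemma out_from_append:
  "out_from T p (u @ v) = (case run T p u of None \<Rightarrow> None
     | Some (q, w) \<Rightarrow> prepend w (out_from T q) v)"
  unfolding prepend_def
proof (induction u arbitrary: p)
  case Nil
  show ?case by (cases "out_from T p v") simp_all
next
  case (Cons a u)
  show ?case
  proof (cases "map_of (delta T) (p, a)")
    case (Some qw)
    then show ?thesis using Cons[of "fst qw"]
      by (cases qw; cases "run T (fst qw) u") (auto simp: map_option_case split: option.splits)
  qed simp
qed

lemma dft_fun_out_from: "dft_fun T = prepend (iout T) (out_from T (q0 T))"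
proof
  fix u
  show "dft_fun T u = prepend (iout T) (out_from T (q0 T)) u"
    using out_from_append[of T "q0 T" u "[]"]
    by (auto simp: dft_fun_def prepend_def option.map_comp comp_def split: option.splits)
qed

text \<open>What has been written on reaching \<open>q\<close> is a left factor and gets stripped,
  so only the state counts; a word without a run falls into the class of the nowhere defined
  function. Hence there are finitely many residuals.\<close>

lemma residual_dft_fun:
  "residual (dft_fun T) u = (case run T (q0 T) u of None \<Rightarrow> (\<lambda>_. None)
     | Some (q, w) \<Rightarrow> strip (out_from T q))"
proof (cases "run T (q0 T) u")
  case None
  then have "(\<lambda>z. dft_fun T (u @ z)) = (\<lambda>_. None)"
    by (simp add: dft_fun_out_from out_from_append prepend_def)
  then show ?thesis by (simp add: residual_def None strip_def)
next
  case (Some qw)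
  have "dft_fun T (u @ z) = prepend (iout T @ snd qw) (out_from T (fst qw)) z" for z
    by (cases "out_from T (fst qw) z")
       (simp_all add: dft_fun_out_from prepend_def out_from_append Some split_def)
  then have "(\<lambda>z. dft_fun T (u @ z)) = prepend (iout T @ snd qw) (out_from T (fst qw))" by blast
  then show ?thesis by (simp add: residual_def Some strip_prepend split_def)
qed

lemma map_of_delta:
  assumes "wf_dft T" "map_of (delta T) (p, a) = Some (q, w)"
  shows "p < nq T" "a < ns T" "q < nq T" "set w \<subseteq> {..<ns T}"
  using assms map_of_SomeD[OF assms(2)] by (auto simp: wf_dft_def)

lemma map_of_fout:
  assumes "wf_dft T" "map_of (fout T) p = Some t"
  shows "p < nq T" "set t \<subseteq> {..<ns T}"
  using assms map_of_SomeD[OF assms(2)] by (auto simp: wf_dft_def)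

lemma run_wf:
  assumes "wf_dft T" "run T p u = Some (q, w)"
  shows "set u \<subseteq> {..<ns T}" "set w \<subseteq> {..<ns T}" "p < nq T \<Longrightarrow> q < nq T"
proof -
  from assms(2) have "set u \<subseteq> {..<ns T} \<and> set w \<subseteq> {..<ns T} \<and> (p < nq T \<longrightarrow> q < nq T)"
  proof (induction u arbitrary: p w)
    case (Cons a u)
    then obtain r v w' where r: "map_of (delta T) (p, a) = Some (r, v)"
      and w': "run T r u = Some (q, w')" "w = v @ w'"
      by (auto split: option.splits)
    show ?case using Cons.IH[OF w'(1)] map_of_delta[OF assms(1) r] w'(2) by simp
  qed simp
  then show "set u \<subseteq> {..<ns T}" "set w \<subseteq> {..<ns T}" "p < nq T \<Longrightarrow> q < nq T"
    by auto
qed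

lemma out_from_wf:
  assumes "wf_dft T" "out_from T p u = Some r"
  shows "u \<in> words T" "set r \<subseteq> {..<ns T}"
proof -
  have *: "Some r = (case run T p u of None \<Rightarrow> None | Some (q, w) \<Rightarrow> map_option ((@) w) (map_of (fout T) q))"
    using assms(2) out_from_append[of T p u "[]"]
    by (cases "run T p u") (auto simp: prepend_def)
  then obtain q w where q: "run T p u = Some (q, w)" by (cases "run T p u") auto
  with * obtain t where t: "map_of (fout T) q = Some t" "r = w @ t"
    by (cases "map_of (fout T) q") auto
  then show "u \<in> words T" "set r \<subseteq> {..<ns T}"
    using run_wf[OF assms(1) q] map_of_fout[OF assms(1) t(1)] t(2) by (auto simp: words_def)
qed

lemma dft_fun_wf:
  assumes "wf_dft T" "dft_fun T u = Some r"
  shows "u \<in> words T" "set r \<subseteq> {..<ns T}"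
proof -
  obtain s where s: "out_from T (q0 T) u = Some s" "r = iout T @ s"
    using assms(2) by (auto simp: dft_fun_out_from prepend_def)
  then show "u \<in> words T" "set r \<subseteq> {..<ns T}"
    using out_from_wf[OF assms(1) s(1)] assms(1) by (auto simp: wf_dft_def)
qed

text \<open>\<open>V_definable\<close> compares on \<open>words T\<close> alone; all other words are
  undefined in both transducers.\<close>

lemma dft_fun_ext:
  assumes "wf_dft T" "wf_dft T'" "ns T' = ns T" "\<And>u. u \<in> words T \<Longrightarrow> dft_fun T' u = dft_fun T u"
  shows "dft_fun T' = dft_fun T"
proof
  fix u
  show "dft_fun T' u = dft_fun T u"
  proof (cases "u \<in> words T")
    case False
    then have "u \<notin> words T'" using assms(3) by (simp add: words_def)
    with False have "dft_fun T u = None" "dft_fun T' u = None"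
      using dft_fun_wf assms(1,2) by (meson option.exhaust)+
    then show ?thesis by simp
  qed (rule assms(4))
qed

lemma runrel_conv:
  "runrel T u = {(p, q). p < nq T \<and> q < nq T \<and> map_option fst (run T p u) = Some q}"
  by (auto simp: runrel_def)

lemma runrel_append:
  assumes "wf_dft T" shows "runrel T (u @ v) = runrel T u O runrel T v"
proof -
  have *: "(\<exists>w. run T p (u @ v) = Some (r, w)) \<longleftrightarrow>
    (\<exists>q w1 w2. run T p u = Some (q, w1) \<and> run T q v = Some (r, w2))" for p r
    by (auto simp: run_append split: option.splits)
  have "(p, r) \<in> runrel T (u @ v) \<longleftrightarrow> (p, r) \<in> runrel T u O runrel T v" for p r
    unfolding relcomp_unfold runrel_def mem_Collect_eq prod.case *
    using run_wf(3)[OF assms] by blast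
  then show ?thesis by auto
qed

text \<open>The run relation fixes the move from the state reached by \<open>x\<close>, and the
  state fixes the residual. So the congruence of equal residuals in all left contexts contains the
  transition congruence of any DFT for the function.\<close>

lemma runrel_eq_residual:
  assumes "wf_dft T" "runrel T u = runrel T v"
  shows "residual (dft_fun T) (x @ u) = residual (dft_fun T) (x @ v)"
proof (cases "run T (q0 T) x")
  case None
  then show ?thesis by (simp add: residual_dft_fun run_append)
next
  case (Some qw)
  define q where "q = fst qw"
  have qx: "run T (q0 T) x = Some (q, snd qw)" using Some by (simp add: q_def)
  have q: "q < nq T" using run_wf(3)[OF assms(1) qx] assms(1) by (simp add: wf_dft_def)
  have *: "(q, r) \<in> runrel T y \<longleftrightarrow> map_option fst (run T q y) = Some r" for r y
    using q run_wf(3)[OF assms(1), of q y r] by (auto simp: runrel_def)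
  have "map_option fst (run T q u) = map_option fst (run T q v)"
    using * assms(2) by (metis option.exhaust)
  then show ?thesis
    by (cases "run T q u"; cases "run T q v") (auto simp: residual_dft_fun run_append qx split: prod.splits)
qed

section \<open>The residual transducer\<close>

lemma finite_residuals:
  assumes "wf_dft T" shows "finite (residual (dft_fun T) ` words T)"
proof (rule finite_subset)
  \<comment> \<open>The extra element accounts for words without a run.\<close>
  show "residual (dft_fun T) ` words T \<subseteq> insert (\<lambda>_. None) ((\<lambda>p. strip (out_from T p)) ` {..<nq T})"
  proof (rule image_subsetI)
    fix u
    show "residual (dft_fun T) u \<in> insert (\<lambda>_. None) ((\<lambda>p. strip (out_from T p)) ` {..<nq T})"
    proof (cases "run T (q0 T) u")
      case (Some qw)
      then have r: "run T (q0 T) u = Some (fst qw, snd qw)" by simp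
      have "fst qw < nq T" using run_wf(3)[OF assms r] assms by (simp add: wf_dft_def)
      then show ?thesis using r by (auto simp: residual_dft_fun split_def)
    qed (simp add: residual_dft_fun)
  qed
qed simp

text \<open>States of a \<open>dft\<close> are numbers, so the finitely many residuals are numbered
  by some bijection \<open>ix\<close>; \<open>st\<close> is its inverse.\<close>

locale residual_dft =
  fixes T :: dft and ix :: "(nat list \<Rightarrow> nat list option) \<Rightarrow> nat"
  assumes wf: "wf_dft T"
    and ix: "bij_betw ix (residual (dft_fun T) ` words T) {..<card (residual (dft_fun T) ` words T)}"
begin

abbreviation "res \<equiv> residual (dft_fun T)"

definition n where "n = card (res ` words T)"

definition st where "st = inv_into (res ` words T) ix"

text \<open>Output is written as early as possible: what remains to be written from a state is
  exactly its residual. The nowhere defined residual, if it occurs, is an ordinary state, which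
  makes \<open>delta\<close> total over the alphabet.\<close>

definition min_dft :: dft where
  "min_dft = DFT n (ns T) (ix (res [])) (lcp (dft_fun T))
     (map (\<lambda>k. (k, (ix (strip (\<lambda>z. st (fst k) (snd k # z))), lcp (\<lambda>z. st (fst k) (snd k # z)))))
       (List.product [0..<n] [0..<ns T]))
     (map (\<lambda>i. (i, the (st i []))) (filter (\<lambda>i. st i [] \<noteq> None) [0..<n]))"

lemma ix_less: "u \<in> words T \<Longrightarrow> ix (res u) < n"
  using ix unfolding n_def by (auto dest: bij_betwE)

lemma st_ix: "u \<in> words T \<Longrightarrow> st (ix (res u)) = res u"
  unfolding st_def using ix by (auto simp: bij_betw_def)

lemma less_nE:
  assumes "i < n" obtains u where "u \<in> words T" "i = ix (res u)" "st i = res u"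
proof -
  have "i \<in> ix ` res ` words T" using assms ix by (simp add: bij_betw_def n_def)
  then show ?thesis using that st_ix by auto
qed

lemma min_dft_sel [simp]:
  "nq min_dft = n" "ns min_dft = ns T" "q0 min_dft = ix (res [])" "iout min_dft = lcp (dft_fun T)"
  by (simp_all add: min_dft_def)

lemma Nil_words: "[] \<in> words T"
  and snoc_words: "u \<in> words T \<Longrightarrow> a < ns T \<Longrightarrow> u @ [a] \<in> words T"
  and append_words: "u \<in> words T \<Longrightarrow> v \<in> words T \<Longrightarrow> u @ v \<in> words T"
  by (auto simp: words_def)

lemma map_of_delta_min:
  assumes "u \<in> words T"
  shows "map_of (delta min_dft) (ix (res u), a) =
    (if a < ns T then Some (ix (res (u @ [a])), lcp (\<lambda>z. res u (a # z))) else None)"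
  unfolding min_dft_def
  using assms ix_less[OF assms] residual_append[of "dft_fun T" u "[a]"]
  by (simp add: map_of_map_restrict restrict_map_def st_ix)

lemma map_of_fout_min:
  assumes "u \<in> words T" shows "map_of (fout min_dft) (ix (res u)) = res u []"
  unfolding min_dft_def
  using assms ix_less[OF assms]
  by (auto simp: map_of_map_restrict restrict_map_def st_ix)

lemma res_SomeD:
  assumes "res u z = Some r" shows "z \<in> words T" "set r \<subseteq> {..<ns T}"
proof -
  obtain s where s: "dft_fun T (u @ z) = Some s"
      "r = drop (length (lcp (\<lambda>z. dft_fun T (u @ z)))) s"
    using assms by (auto simp: residual_def strip_def)
  then show "z \<in> words T" "set r \<subseteq> {..<ns T}"
    using dft_fun_wf[OF wf s(1)] by (auto simp: words_def dest: in_set_dropD)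
qed

lemma set_lcp:
  assumes "\<And>z r. h z = Some r \<Longrightarrow> set r \<subseteq> A" shows "set (lcp h) \<subseteq> A"
proof (cases "\<forall>z. h z = None")
  case False
  then obtain z r where "h z = Some r" by auto
  then have "\<exists>s. r = lcp h @ s" using fun_cong[OF prepend_lcp_strip[of h], of z]
    by (auto simp: prepend_def)
  then show ?thesis using assms \<open>h z = Some r\<close> by fastforce
qed (simp add: lcp_None)

lemma wf_min: "wf_dft min_dft"
proof -
  have d: "ix (strip (\<lambda>z. st i (a # z))) < n" "set (lcp (\<lambda>z. st i (a # z))) \<subseteq> {..<ns T}"
    if ia: "i < n" "a < ns T" for i a
  proof -
    obtain u where u: "u \<in> words T" "st i = res u" using ia(1) by (rule less_nE)
    show "ix (strip (\<lambda>z. st i (a # z))) < n"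
      using ix_less[OF snoc_words[OF u(1) ia(2)]] u(2) by (simp add: residual_append)
    show "set (lcp (\<lambda>z. st i (a # z))) \<subseteq> {..<ns T}"
      unfolding u(2) by (rule set_lcp) (rule res_SomeD)
  qed
  have t: "set r \<subseteq> {..<ns T}" if "i < n" "st i [] = Some r" for i r
    using that by (metis less_nE res_SomeD(2))
  have "set (lcp (dft_fun T)) \<subseteq> {..<ns T}" by (rule set_lcp) (rule dft_fun_wf[OF wf])
  moreover have "distinct (map fst (delta min_dft))" "distinct (map fst (fout min_dft))"
    by (simp_all add: min_dft_def comp_def distinct_product)
  moreover have "\<forall>((p,a),(q,w)) \<in> set (delta min_dft). p < n \<and> a < ns T \<and> q < n \<and> set w \<subseteq> {..<ns T}"
    using d by (auto simp: min_dft_def)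
  moreover have "\<forall>(q,w) \<in> set (fout min_dft). q < n \<and> set w \<subseteq> {..<ns T}"
    using t by (fastforce simp: min_dft_def)
  ultimately show ?thesis
    using ix_less[OF Nil_words] unfolding wf_dft_def by simp
qed

lemma run_min:
  assumes "u \<in> words T" "v \<in> words T"
  shows "map_option fst (run min_dft (ix (res u)) v) = Some (ix (res (u @ v)))"
  using assms
proof (induction v arbitrary: u)
  case (Cons a v)
  then have a: "a < ns T" "v \<in> words T" by (auto simp: words_def)
  have "map_option fst (run min_dft (ix (res (u @ [a]))) v) = Some (ix (res (u @ a # v)))"
    using Cons.IH[OF snoc_words[OF Cons.prems(1) a(1)] a(2)] by simp
  then show ?case
    using a Cons.prems by (auto simp: map_of_delta_min)
qed simp

lemma out_from_min:
  assumes "u \<in> words T" shows "out_from min_dft (ix (res u)) z = res u z"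
  using assms
proof (induction z arbitrary: u)
  case Nil
  then show ?case by (simp add: map_of_fout_min)
next
  case (Cons a z)
  show ?case
  proof (cases "a < ns T")
    case True
    have "res u (a # z) = map_option ((@) (lcp (\<lambda>z. res u (a # z)))) (res (u @ [a]) z)"
      using fun_cong[OF prepend_lcp_strip[of "\<lambda>z. res u (a # z)"], of z]
      by (simp add: residual_append prepend_def)
    then show ?thesis
      using True Cons by (simp add: map_of_delta_min snoc_words)
  next
    case False
    then have "a # z \<notin> words T" by (simp add: words_def)
    then have "res u (a # z) = None" using res_SomeD(1) by (meson option.exhaust)
    then show ?thesis using False Cons by (simp add: map_of_delta_min)
  qed
qed

lemma dft_fun_min: "dft_fun min_dft = dft_fun T"
proof -
  have "out_from min_dft (ix (res [])) = res []"
    using out_from_min[OF Nil_words] by blast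
  then show ?thesis
    by (simp add: dft_fun_out_from[of min_dft] residual_def prepend_lcp_strip)
qed

text \<open>Converse of \<open>runrel_eq_residual\<close>, special to \<open>min_dft\<close>: each
  of its states is the residual of some word \<open>x\<close>, so comparing residuals after all
  \<open>x\<close> compares the actions on all states.\<close>

lemma runrel_min_cong:
  assumes "u \<in> words T" "v \<in> words T" "\<And>x. x \<in> words T \<Longrightarrow> res (x @ u) = res (x @ v)"
  shows "runrel min_dft u = runrel min_dft v"
proof -
  have "map_option fst (run min_dft p u) = map_option fst (run min_dft p v)" if "p < n" for p
    using that by (rule less_nE) (simp add: run_min assms)
  then have "(p, q) \<in> runrel min_dft u \<longleftrightarrow> (p, q) \<in> runrel min_dft v" for p q
    unfolding runrel_conv mem_Collect_eq prod.case min_dft_sel by metis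
  then show ?thesis by auto
qed

end

lemma ex_residual_dft:
  assumes "wf_dft T" shows "\<exists>ix. residual_dft T ix"
  using ex_bij_betw_finite_nat[OF finite_residuals[OF assms]] assms
  by (auto simp: residual_dft_def atLeast0LessThan)

section \<open>Certificates\<close>

text \<open>A stand-in for \<open>runrel\<close> that can be computed and compared as a list;
  \<open>nq T\<close>, which is no state, marks a missing run.\<close>

definition acts :: "dft \<Rightarrow> nat list \<Rightarrow> nat list" where
  "acts T u = map (\<lambda>p. case run T p u of None \<Rightarrow> nq T | Some (q, w) \<Rightarrow> q) [0..<nq T]"

lemma acts_eq_iff:
  assumes "wf_dft T" shows "acts T u = acts T v \<longleftrightarrow> runrel T u = runrel T v"
proof -
  let ?g = "\<lambda>x. case x of None \<Rightarrow> nq T | Some q \<Rightarrow> q"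
  let ?r = "\<lambda>u p. map_option fst (run T p u)"
  have lt: "q < nq T" if "?r u p = Some q" "p < nq T" for p q u
    using that run_wf(3)[OF assms] by auto
  have g_inj: "?g x = ?g y \<longleftrightarrow> x = y"
    if "\<forall>q. x = Some q \<longrightarrow> q < nq T" "\<forall>q. y = Some q \<longrightarrow> q < nq T" for x y
    using that by (cases x; cases y) auto
  have "acts T u = map (\<lambda>p. ?g (?r u p)) [0..<nq T]" for u
    by (auto simp: acts_def split: option.splits)
  then have "acts T u = acts T v \<longleftrightarrow> (\<forall>p<nq T. ?g (?r u p) = ?g (?r v p))" by auto
  also have "\<dots> \<longleftrightarrow> (\<forall>p<nq T. ?r u p = ?r v p)"
    using lt g_inj by (intro all_cong) metis
  also have "\<dots> \<longleftrightarrow> runrel T u = runrel T v"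
  proof
    assume rr: "runrel T u = runrel T v"
    have "(p, q) \<in> runrel T u \<longleftrightarrow> ?r u p = Some q" if "p < nq T" for p q u
      using that lt unfolding runrel_conv by blast
    then have "?r u p = Some q \<longleftrightarrow> ?r v p = Some q" if "p < nq T" for p q
      using that rr by metis
    then show "\<forall>p<nq T. ?r u p = ?r v p"
      by (metis option.exhaust)
  next
    assume e: "\<forall>p<nq T. ?r u p = ?r v p"
    have "(p, q) \<in> runrel T u \<longleftrightarrow> (p, q) \<in> runrel T v" for p q
      using e unfolding runrel_conv mem_Collect_eq prod.case by metis
    then show "runrel T u = runrel T v" by auto
  qed
  finally show ?thesis .
qed

text \<open>An invariant that rules out all outputs: closed under transitions and free of final
  states. Unlike deadness itself it is checked locally.\<close>

definition dead_set :: "dft \<Rightarrow> nat list \<Rightarrow> bool" where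
  "dead_set T D \<longleftrightarrow> (\<forall>((p, a), (q, w)) \<in> set (delta T). p \<in> set D \<longrightarrow> q \<in> set D)
     \<and> (\<forall>(q, t) \<in> set (fout T). q \<notin> set D)"

lemma dead_set_sound:
  assumes "dead_set T D" "p \<in> set D" shows "out_from T p u = None"
  using assms(2)
proof (induction u arbitrary: p)
  case Nil
  then show ?case using assms(1)
    by (cases "map_of (fout T) p") (auto simp: dead_set_def dest!: map_of_SomeD)
next
  case (Cons a u)
  show ?case
  proof (cases "map_of (delta T) (p, a)")
    case (Some qw)
    obtain q w where qw: "qw = (q, w)" by (cases qw)
    have "((p, a), (q, w)) \<in> set (delta T)" using Some qw by (simp add: map_of_SomeD)
    then have "q \<in> set D" using assms(1) Cons.prems by (auto simp: dead_set_def)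
    then show ?thesis using Cons.IH Some qw by simp
  qed simp
qed

lemma ex_dead_set:
  assumes "wf_dft T"
  shows "\<exists>D. dead_set T D \<and> (\<forall>p<nq T. (\<forall>u. out_from T p u = None) \<longrightarrow> p \<in> set D)"
proof -
  \<comment> \<open>The set of all dead states is closed, because an output from a successor would
    give one from the state.\<close>
  define D where "D = filter (\<lambda>p. \<forall>u. out_from T p u = None) [0..<nq T]"
  have "q \<in> set D" if "((p, a), (q, w)) \<in> set (delta T)" "p \<in> set D" for p a q w
  proof -
    have m: "map_of (delta T) (p, a) = Some (q, w)"
      using that(1) assms by (simp add: wf_dft_def)
    have "out_from T q u = None" for u
      using that(2) m by (auto simp: D_def dest: spec[of _ "a # u"])
    then show ?thesis using map_of_delta(3)[OF assms m] by (simp add: D_def)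
  qed
  moreover have "q \<notin> set D" if "(q, t) \<in> set (fout T)" for q t
  proof -
    have "out_from T q [] = Some t" using that assms by (simp add: wf_dft_def)
    then have "\<not> (\<forall>u. out_from T q u = None)" by (metis option.distinct(1))
    then show ?thesis by (simp add: D_def)
  qed
  ultimately have "dead_set T D" by (auto simp: dead_set_def)
  moreover have "\<forall>p<nq T. (\<forall>u. out_from T p u = None) \<longrightarrow> p \<in> set D" by (simp add: D_def)
  ultimately show ?thesis by blast
qed

text \<open>A triple \<open>(p, p', w)\<close> asserts that the outputs of \<open>T\<close> from \<open>p\<close> are those of \<open>T'\<close>
  from \<open>p'\<close> with \<open>w\<close> prepended.\<close>
definition related ::
  "nat list \<Rightarrow> nat list \<Rightarrow> (nat \<times> nat \<times> nat list) list \<Rightarrow> nat list \<Rightarrow> nat \<Rightarrow> nat list \<Rightarrow> nat \<Rightarrow> nat list \<Rightarrow> bool"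
where
  "related D D' R v q v' q' w \<longleftrightarrow> q \<in> set D \<and> q' \<in> set D'
     \<or> (\<exists>z\<in>set R. fst z = q \<and> fst (snd z) = q' \<and> w @ v' = v @ snd (snd z))"

text \<open>The left factor stands on one side only, since the intended \<open>T'\<close>,
  \<open>min_dft\<close>, never writes later than \<open>T\<close>. Steps into dead states are
  exempt: no left factor is determined there, and \<open>T\<close> may block where \<open>T'\<close>
  enters a sink.\<close>

definition simulation ::
  "dft \<Rightarrow> dft \<Rightarrow> nat list \<Rightarrow> nat list \<Rightarrow> (nat \<times> nat \<times> nat list) list \<Rightarrow> bool" where
  "simulation T T' D D' R \<longleftrightarrow>
     dead_set T D \<and> dead_set T' D'
     \<and> related D D' R (iout T) (q0 T) (iout T') (q0 T') []
     \<and> (\<forall>(p, p', w) \<in> set R.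
          map_of (fout T) p = map_option ((@) w) (map_of (fout T') p')
        \<and> (\<forall>a\<in>set [0..<ns T]. case map_of (delta T) (p, a) of
             None \<Rightarrow> (case map_of (delta T') (p', a) of None \<Rightarrow> True | Some (q', v') \<Rightarrow> q' \<in> set D')
           | Some (q, v) \<Rightarrow> (case map_of (delta T') (p', a) of None \<Rightarrow> q \<in> set D
               | Some (q', v') \<Rightarrow> related D D' R v q v' q' w)))"

text \<open>With the invariant for \<open>(q, q', x)\<close> the two sides become
  \<open>v @ x @ s\<close> and \<open>w @ v' @ s\<close>, equal by \<open>related\<close>; for a
  dead pair both sides are undefined.\<close>

lemma related_sound:
  assumes "dead_set T D" "dead_set T' D'" "related D D' R v q v' q' w"
    and "\<And>x. (q, q', x) \<in> set R \<Longrightarrow> out_from T q u = map_option ((@) x) (out_from T' q' u)"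
  shows "map_option ((@) v) (out_from T q u) = map_option ((@) w) (map_option ((@) v') (out_from T' q' u))"
proof (cases "q \<in> set D \<and> q' \<in> set D'")
  case True
  then show ?thesis using dead_set_sound assms(1,2) by simp
next
  case False
  then obtain x where x: "(q, q', x) \<in> set R" "w @ v' = v @ x"
    using assms(3) by (auto simp: related_def)
  have "w @ v' @ s = v @ x @ s" for s using x(2) by (metis append_assoc)
  then show ?thesis using assms(4)[OF x(1)] by (cases "out_from T' q' u") simp_all
qed

lemma simulation_sound:
  assumes "wf_dft T" "wf_dft T'" "ns T' = ns T" "simulation T T' D D' R"
  shows "dft_fun T' = dft_fun T"
proof -
  have dead: "dead_set T D" "dead_set T' D'" using assms(4) by (auto simp: simulation_def)
  have R: "out_from T p u = map_option ((@) w) (out_from T' p' u)"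
    if "(p, p', w) \<in> set R" for p p' w u
    using that
  proof (induction u arbitrary: p p' w)
    case Nil
    then show ?case using assms(4) by (auto simp: simulation_def)
  next
    case (Cons a u)
    show ?case
    proof (cases "a < ns T")
      case False
      then have "map_of (delta T) (p, a) = None" "map_of (delta T') (p', a) = None"
        using map_of_delta(2) assms(1-3) by (metis option.exhaust surj_pair)+
      then show ?thesis by simp
    next
      case True
      then have step: "case map_of (delta T) (p, a) of
             None \<Rightarrow> (case map_of (delta T') (p', a) of None \<Rightarrow> True | Some (q', v') \<Rightarrow> q' \<in> set D')
           | Some (q, v) \<Rightarrow> (case map_of (delta T') (p', a) of None \<Rightarrow> q \<in> set D
               | Some (q', v') \<Rightarrow> related D D' R v q v' q' w)"
        using assms(4) Cons.prems unfolding simulation_def by fastforce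
      show ?thesis
      proof (cases "map_of (delta T) (p, a)")
        case None
        then show ?thesis using step dead_set_sound[OF dead(2)]
          by (cases "map_of (delta T') (p', a)") auto
      next
        case (Some qv)
        obtain q v where qv: "qv = (q, v)" by (cases qv)
        show ?thesis
        proof (cases "map_of (delta T') (p', a)")
          case None
          then show ?thesis using step dead_set_sound[OF dead(1)] Some by auto
        next
          case (Some qv')
          obtain q' v' where qv': "qv' = (q', v')" by (cases qv')
          have "related D D' R v q v' q' w"
            using step Some \<open>map_of (delta T) (p, a) = Some qv\<close> qv qv' by simp
          from related_sound[OF dead this Cons.IH] show ?thesis
            using Some \<open>map_of (delta T) (p, a) = Some qv\<close> qv qv' by simp
        qed
      qed
    qed
  qed
  have rel: "related D D' R (iout T) (q0 T) (iout T') (q0 T') []"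
    using assms(4) by (simp add: simulation_def)
  show ?thesis
  proof
    fix u
    show "dft_fun T' u = dft_fun T u"
      using related_sound[OF dead rel R, of u]
      by (simp add: dft_fun_out_from prepend_def option.map_comp comp_def)
  qed
qed

section \<open>Evidence that two residuals differ\<close>

text \<open>Undefined values count as agreement, for a difference of domains is the separate first
  alternative of \<open>separated\<close>.\<close>

definition agree :: "nat list \<Rightarrow> nat list \<Rightarrow> nat list option \<Rightarrow> nat list option \<Rightarrow> bool" where
  "agree v w x y \<longleftrightarrow> (case x of None \<Rightarrow> True | Some r \<Rightarrow> (case y of None \<Rightarrow> True | Some s \<Rightarrow>
     take (length v) r = v \<and> take (length w) s = w \<and> drop (length v) r = drop (length w) s))"

text \<open>The words in \<open>Z\<close> witness that the residuals of \<open>u\<close> and \<open>v\<close> differ even up to left factors: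
  any pair of left factors would have to be a pair of prefixes of the outputs at \<open>z0\<close>.\<close>
definition separated :: "dft \<Rightarrow> nat list \<Rightarrow> nat list \<Rightarrow> nat list list \<Rightarrow> bool" where
  "separated T u v Z \<longleftrightarrow>
     (\<exists>z\<in>set Z. (dft_fun T (u @ z) = None) \<noteq> (dft_fun T (v @ z) = None))
   \<or> (\<exists>z0\<in>set Z. case dft_fun T (u @ z0) of None \<Rightarrow> False | Some r \<Rightarrow>
       (case dft_fun T (v @ z0) of None \<Rightarrow> False | Some s \<Rightarrow>
         (\<forall>i\<in>set [0..<Suc (length r)]. \<forall>j\<in>set [0..<Suc (length s)]. \<exists>z\<in>set Z.
            \<not> agree (take i r) (take j s) (dft_fun T (u @ z)) (dft_fun T (v @ z)))))"

text \<open>The definition uses \<open>case\<close> and quantifiers over list elements because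
  \<open>comp_intros\<close> compiles these; this form is the one to reason with.\<close>

lemma separated_iff:
  "separated T u v Z \<longleftrightarrow>
     (\<exists>z\<in>set Z. (dft_fun T (u @ z) = None) \<noteq> (dft_fun T (v @ z) = None))
   \<or> (\<exists>z0\<in>set Z. \<exists>r s. dft_fun T (u @ z0) = Some r \<and> dft_fun T (v @ z0) = Some s
       \<and> (\<forall>i\<le>length r. \<forall>j\<le>length s. \<exists>z\<in>set Z.
            \<not> agree (take i r) (take j s) (dft_fun T (u @ z)) (dft_fun T (v @ z))))"
proof -
  have [simp]: "(case x of None \<Rightarrow> False | Some r \<Rightarrow> P r) \<longleftrightarrow> (\<exists>r. x = Some r \<and> P r)"
    for x :: "nat list option" and P by (cases x) auto
  have [simp]: "(\<forall>i\<in>set [0..<Suc n]. P i) \<longleftrightarrow> (\<forall>i\<le>n. P i)" for n P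
    by (auto simp: less_Suc_eq_le)
  show ?thesis by (simp add: separated_def del: upt_Suc set_upt)
qed

lemma separated_mono: "separated T u v Z \<Longrightarrow> set Z \<subseteq> set Z' \<Longrightarrow> separated T u v Z'"
  unfolding separated_iff by (meson subsetD)

lemma separated_sound:
  assumes "separated T u v Z" shows "residual (dft_fun T) u \<noteq> residual (dft_fun T) v"
proof
  assume "residual (dft_fun T) u = residual (dft_fun T) v"
  then obtain x y g where g: "(\<lambda>z. dft_fun T (u @ z)) = prepend x g" "(\<lambda>z. dft_fun T (v @ z)) = prepend y g"
    unfolding residual_def strip_eq_iff by blast
  have g': "dft_fun T (u @ z) = map_option ((@) x) (g z)" "dft_fun T (v @ z) = map_option ((@) y) (g z)" for z
    using fun_cong[OF g(1), of z] fun_cong[OF g(2), of z] by (simp_all add: prepend_def)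
  have "\<not> (\<exists>z\<in>set Z. (dft_fun T (u @ z) = None) \<noteq> (dft_fun T (v @ z) = None))"
    by (simp add: g')
  with assms obtain z0 r s where r: "dft_fun T (u @ z0) = Some r" and s: "dft_fun T (v @ z0) = Some s"
    and all: "\<forall>i\<le>length r. \<forall>j\<le>length s. \<exists>z\<in>set Z.
            \<not> agree (take i r) (take j s) (dft_fun T (u @ z)) (dft_fun T (v @ z))"
    unfolding separated_iff by blast
  obtain h where h: "r = x @ h" "s = y @ h"
    using r s g'[of z0] by (cases "g z0") auto
  have "agree x y (dft_fun T (u @ z)) (dft_fun T (v @ z))" for z
    by (cases "g z") (simp_all add: agree_def g')
  \<comment> \<open>The actual left factors \<open>x\<close> and \<open>y\<close> are prefixes of
    \<open>r\<close> and \<open>s\<close>, so they occur among the tested pairs.\<close>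
  then show False using all[rule_format, of "length x" "length y"] h by simp
qed

text \<open>Once \<open>z0\<close> is fixed, finitely many pairs of prefixes compete, and each is
  refuted by some word; a finite list of these words suffices.\<close>

lemma separated_complete:
  assumes "residual (dft_fun T) u \<noteq> residual (dft_fun T) v"
  shows "\<exists>Z. separated T u v Z"
proof (rule ccontr)
  assume not: "\<nexists>Z. separated T u v Z"
  \<comment> \<open>A word in exactly one of the two domains would be a separating list by
    itself.\<close>
  have dom: "dft_fun T (u @ z) = None \<longleftrightarrow> dft_fun T (v @ z) = None" for z
    using not[simplified, rule_format, of "[z]"] by (auto simp: separated_def)
  obtain z0 where "dft_fun T (u @ z0) \<noteq> None"
  proof (cases "\<forall>z. dft_fun T (u @ z) = None")
    case True
    then have "(\<lambda>z. dft_fun T (u @ z)) = (\<lambda>z. dft_fun T (v @ z))" using dom by simp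
    then show ?thesis using assms by (simp add: residual_def)
  qed (use that in blast)
  then obtain r s where rs: "dft_fun T (u @ z0) = Some r" "dft_fun T (v @ z0) = Some s"
    using dom[of z0] by auto
  let ?bad = "\<lambda>i j z. \<not> agree (take i r) (take j s) (dft_fun T (u @ z)) (dft_fun T (v @ z))"
  have "\<exists>z. ?bad i j z" for i j
  proof (rule ccontr)
    assume "\<nexists>z. ?bad i j z"
    then have a: "agree (take i r) (take j s) (dft_fun T (u @ z)) (dft_fun T (v @ z))" for z by blast
    let ?x = "take i r" and ?y = "take j s"
    let ?g = "\<lambda>z. map_option (drop (length ?x)) (dft_fun T (u @ z))"
    have "dft_fun T (u @ z) = prepend ?x ?g z \<and> dft_fun T (v @ z) = prepend ?y ?g z" for z
    proof (cases "dft_fun T (u @ z)")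
      case None
      then show ?thesis using dom[of z] by (simp add: prepend_def)
    next
      case (Some r')
      moreover obtain s' where "dft_fun T (v @ z) = Some s'" using dom[of z] Some by auto
      ultimately show ?thesis using a[of z]
        by (simp add: agree_def prepend_def del: length_take) (metis append_take_drop_id)
    qed
    then have "(\<lambda>z. dft_fun T (u @ z)) = prepend ?x ?g" "(\<lambda>z. dft_fun T (v @ z)) = prepend ?y ?g"
      by blast+
    then show False using assms unfolding residual_def strip_eq_iff by blast
  qed
  then obtain b where b: "\<And>i j. ?bad i j (b i j)" by metis
  define Z where "Z = z0 # map (\<lambda>(i, j). b i j) (List.product [0..<Suc (length r)] [0..<Suc (length s)])"
  have "b i j \<in> set Z" if "i \<le> length r" "j \<le> length s" for i j
  proof -
    have "(i, j) \<in> set (List.product [0..<Suc (length r)] [0..<Suc (length s)])" using that by auto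
    then have "(\<lambda>(i, j). b i j) (i, j) \<in> set (map (\<lambda>(i, j). b i j)
        (List.product [0..<Suc (length r)] [0..<Suc (length s)]))"
      unfolding set_map by (rule imageI)
    then show ?thesis unfolding Z_def by simp
  qed
  then have "\<forall>i\<le>length r. \<forall>j\<le>length s. \<exists>z\<in>set Z. ?bad i j z" using b by blast
  moreover have "z0 \<in> set Z" by (simp add: Z_def)
  ultimately have "separated T u v Z" unfolding separated_iff using rs by blast
  then show False using not by blast
qed

section \<open>The multiplication table of the representatives\<close>

text \<open>Position of the first word of \<open>W\<close> that acts like \<open>u\<close>, or
  \<open>length W\<close> if there is none.\<close>

definition idx :: "dft \<Rightarrow> nat list list \<Rightarrow> nat list \<Rightarrow> nat" where
  "idx T W u = foldr (\<lambda>w k. if acts T w = acts T u then 0 else Suc k) W 0"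

definition rep_table :: "dft \<Rightarrow> nat list list \<Rightarrow> mtable" where
  "rep_table T W = (length W, idx T W [], \<lambda>i j. idx T W (W ! i @ W ! j))"

lemma idx_found:
  assumes "\<exists>w\<in>set W. acts T w = acts T u"
  shows "idx T W u < length W \<and> acts T (W ! idx T W u) = acts T u"
  using assms unfolding idx_def by (induction W) auto

lemma idx_cong: "acts T u = acts T v \<Longrightarrow> idx T W u = idx T W v"
  by (simp add: idx_def)

text \<open>All that the table needs: \<open>W\<close> represents every action, and no DFT for the
  same function can merge two words of \<open>W\<close>. The transducer need not be
  \<open>min_dft\<close>.\<close>

definition choffrut_reps :: "dft \<Rightarrow> nat list list \<Rightarrow> bool" where
  "choffrut_reps T W \<longleftrightarrow> wf_dft T \<and> distinct W \<and> set W \<subseteq> words T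
     \<and> (\<forall>u\<in>words T. \<exists>w\<in>set W. acts T w = acts T u)
     \<and> (\<forall>u\<in>set W. \<forall>v\<in>set W. u \<noteq> v \<longrightarrow>
          (\<exists>x. residual (dft_fun T) (x @ u) \<noteq> residual (dft_fun T) (x @ v)))"

locale choffrut =
  fixes T :: dft and W :: "nat list list"
  assumes reps: "choffrut_reps T W"
begin

lemma wf: "wf_dft T" and W_words: "w \<in> set W \<Longrightarrow> w \<in> words T"
  using reps by (auto simp: choffrut_reps_def)

lemma Nil_words: "[] \<in> words T"
  and append_words: "u \<in> words T \<Longrightarrow> v \<in> words T \<Longrightarrow> u @ v \<in> words T"
  by (auto simp: words_def)

abbreviation "rp u \<equiv> W ! idx T W u"

lemma idx_less: "u \<in> words T \<Longrightarrow> idx T W u < length W"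
  and runrel_rp: "u \<in> words T \<Longrightarrow> runrel T (rp u) = runrel T u"
  using idx_found[of W T u] reps acts_eq_iff[OF wf] by (auto simp: choffrut_reps_def)

lemma idx_runrel: "runrel T u = runrel T v \<Longrightarrow> idx T W u = idx T W v"
  using idx_cong acts_eq_iff[OF wf] by blast

lemma idx_append_rp:
  assumes "u \<in> words T" "v \<in> words T" shows "idx T W (rp u @ rp v) = idx T W (u @ v)"
  by (rule idx_runrel) (simp add: runrel_append[OF wf] runrel_rp assms)

lemma runrel_idx: "u \<in> words T \<Longrightarrow> v \<in> words T \<Longrightarrow> idx T W u = idx T W v \<Longrightarrow> runrel T u = runrel T v"
  by (metis runrel_rp)

text \<open>In every left context a representative has the residual of the word it stands for, so
  the separation demanded in \<open>choffrut_reps\<close> forces the two representatives to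
  coincide.\<close>

lemma idx_residual:
  assumes "u \<in> words T" "v \<in> words T"
    and "\<And>x. residual (dft_fun T) (x @ u) = residual (dft_fun T) (x @ v)"
  shows "idx T W u = idx T W v"
proof -
  have "residual (dft_fun T) (x @ rp u) = residual (dft_fun T) (x @ rp v)" for x
    using runrel_eq_residual[OF wf runrel_rp] assms by simp
  moreover have "rp u \<in> set W" "rp v \<in> set W" using idx_less assms by simp_all
  ultimately have "rp u = rp v" using reps unfolding choffrut_reps_def by meson
  then show ?thesis using idx_less assms reps by (simp add: choffrut_reps_def nth_eq_iff_index_eq)
qed

text \<open>Different words of \<open>W\<close> act differently, as their residuals differ in some
  context; so the first match is the word itself.\<close>

lemma idx_nth:
  assumes "i < length W" shows "idx T W (W ! i) = i"
proof -
  have w: "W ! i \<in> words T" using assms W_words by simp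
  have "rp (W ! i) = W ! i"
  proof (rule ccontr)
    assume "rp (W ! i) \<noteq> W ! i"
    then obtain x where "residual (dft_fun T) (x @ rp (W ! i)) \<noteq> residual (dft_fun T) (x @ W ! i)"
      using reps idx_less[OF w] assms unfolding choffrut_reps_def by (meson nth_mem)
    then show False using runrel_eq_residual[OF wf runrel_rp[OF w]] by simp
  qed
  then show ?thesis using idx_less[OF w] assms reps
    by (simp add: choffrut_reps_def nth_eq_iff_index_eq)
qed

lemma table_simps:
  "mcard (rep_table T W) = length W" "munit (rep_table T W) = idx T W []"
  "mmul (rep_table T W) = (\<lambda>i j. idx T W (W ! i @ W ! j))"
  by (simp_all add: rep_table_def mcard_def munit_def mmul_def)

lemma mmul_idx:
  "u \<in> words T \<Longrightarrow> v \<in> words T \<Longrightarrow> mmul (rep_table T W) (idx T W u) (idx T W v) = idx T W (u @ v)"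
  by (simp add: table_simps idx_append_rp)

text \<open>Associativity and unit are inherited from concatenation. The procedure for
  \<open>V\<close> relies on this too, being specified on finite monoids only.\<close>

lemma fmon_table: "fmon (rep_table T W)"
proof -
  let ?mul = "\<lambda>i j. idx T W (W ! i @ W ! j)"
  have W: "W ! i \<in> words T" if "i < length W" for i using that W_words by simp
  have mul: "?mul i j = idx T W (W ! i @ W ! j)" "?mul i j < length W"
    if "i < length W" "j < length W" for i j
    using that W by (simp_all add: idx_less append_words)
  have "?mul (?mul i j) k = ?mul i (?mul j k)"
    if "i < length W" "j < length W" "k < length W" for i j k
  proof -
    have "?mul (?mul i j) k = idx T W ((W ! i @ W ! j) @ W ! k)"
      using idx_append_rp[OF append_words[OF W W] W, of i j k] that by (simp add: idx_nth)
    also have "\<dots> = ?mul i (?mul j k)"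
      using idx_append_rp[OF W append_words[OF W W], of i j k] that by (simp add: idx_nth)
    finally show ?thesis .
  qed
  moreover have "?mul (idx T W []) i = i" "?mul i (idx T W []) = i" if "i < length W" for i
    using idx_append_rp[OF Nil_words W[OF that]] idx_append_rp[OF W[OF that] Nil_words] idx_nth[OF that]
    by simp_all
  ultimately show ?thesis
    using idx_less[OF Nil_words] mul(2) by (simp add: fmon_def rep_table_def)
qed

text \<open>The table is a copy of the transition monoid: a run relation goes to the index of any
  word inducing it.\<close>

lemma table_tm_in:
  assumes "V (rep_table T W)" shows "tm_in V T"
proof -
  define f where "f r = idx T W (SOME u. u \<in> words T \<and> runrel T u = r)" for r
  have f: "f (runrel T u) = idx T W u" if "u \<in> words T" for u
  proof -
    have "(SOME v. v \<in> words T \<and> runrel T v = runrel T u) \<in> words T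
        \<and> runrel T (SOME v. v \<in> words T \<and> runrel T v = runrel T u) = runrel T u"
      by (rule someI[of _ u]) (simp add: that)
    then show ?thesis unfolding f_def using idx_runrel by blast
  qed
  have "bij_betw f (trans_monoid T) {..<mcard (rep_table T W)}"
  proof (rule bij_betw_imageI)
    show "inj_on f (trans_monoid T)"
    proof (rule inj_onI)
      fix r s assume rs: "r \<in> trans_monoid T" "s \<in> trans_monoid T" and eq: "f r = f s"
      from rs obtain u v where "u \<in> words T" "r = runrel T u" "v \<in> words T" "s = runrel T v"
        unfolding trans_monoid_def by (elim imageE)
      then show "r = s" using eq f runrel_idx by metis
    qed
    show "f ` trans_monoid T = {..<mcard (rep_table T W)}"
    proof
      show "f ` trans_monoid T \<subseteq> {..<mcard (rep_table T W)}"
        by (auto simp: trans_monoid_def f table_simps idx_less)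
      show "{..<mcard (rep_table T W)} \<subseteq> f ` trans_monoid T"
      proof
        fix i assume "i \<in> {..<mcard (rep_table T W)}"
        then have i: "i < length W" by (simp add: table_simps)
        then have "W ! i \<in> words T" using W_words by simp
        then have "f (runrel T (W ! i)) = i" "runrel T (W ! i) \<in> trans_monoid T"
          by (simp_all add: f idx_nth[OF i] trans_monoid_def)
        then show "i \<in> f ` trans_monoid T" by force
      qed
    qed
  qed
  moreover have "f (runrel T []) = munit (rep_table T W)" by (simp add: f Nil_words table_simps)
  moreover have "f (r O s) = mmul (rep_table T W) (f r) (f s)"
    if "r \<in> trans_monoid T" "s \<in> trans_monoid T" for r s
    using that by (auto simp: trans_monoid_def f mmul_idx append_words simp flip: runrel_append[OF wf])
  ultimately show ?thesis using assms unfolding tm_in_def by blast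
qed

text \<open>Sending an element of \<open>M\<close> to the index of any word inducing it is well
  defined, because equal run relations in \<open>T'\<close> give equal residuals in all contexts of
  the common function. The map is onto the table, and \<open>V\<close> is closed under homomorphic
  images.\<close>

lemma tm_in_table:
  assumes V: "monoid_variety V" and T': "V_dft V T'" "ns T' = ns T" "dft_fun T' = dft_fun T"
  shows "V (rep_table T W)"
proof -
  have wf': "wf_dft T'" using T' by (simp add: V_dft_def)
  have words': "words T' = words T" using T'(2) by (simp add: words_def)
  obtain M f where M: "V M" and bij: "bij_betw f (trans_monoid T') {..<mcard M}"
    and one: "f (runrel T' []) = munit M"
    and mult: "\<And>r s. r \<in> trans_monoid T' \<Longrightarrow> s \<in> trans_monoid T' \<Longrightarrow> f (r O s) = mmul M (f r) (f s)"
    using T'(1) unfolding V_dft_def tm_in_def by blast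
  define h where "h x = idx T W (SOME u. u \<in> words T \<and> f (runrel T' u) = x)" for x
  have tm: "runrel T' u \<in> trans_monoid T'" if "u \<in> words T" for u
    using that by (simp add: trans_monoid_def words')
  have h: "h (f (runrel T' u)) = idx T W u" if "u \<in> words T" for u
  proof -
    let ?v = "SOME v. v \<in> words T \<and> f (runrel T' v) = f (runrel T' u)"
    have v: "?v \<in> words T \<and> f (runrel T' ?v) = f (runrel T' u)"
      by (rule someI[of _ u]) (simp add: that)
    \<comment> \<open>\<open>f\<close> is injective on run relations.\<close>
    then have "runrel T' ?v = runrel T' u"
      using bij tm that by (meson bij_betw_imp_inj_on inj_onD)
    then have "residual (dft_fun T) (x @ ?v) = residual (dft_fun T) (x @ u)" for x
      using runrel_eq_residual[OF wf'] T'(3) by metis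
    then show ?thesis unfolding h_def using idx_residual v that by blast
  qed
  have ex: "\<exists>u\<in>words T. x = f (runrel T' u)" if "x < mcard M" for x
  proof -
    have "x \<in> f ` trans_monoid T'" using that bij by (simp add: bij_betw_def)
    then show ?thesis by (auto simp: trans_monoid_def words')
  qed
  have fm: "f (runrel T' u) < mcard M" if "u \<in> words T" for u
    using bij tm[OF that] by (auto dest: bij_betwE)
  have "mhom M (rep_table T W) h"
    unfolding mhom_def
  proof (intro conjI allI impI)
    fix x assume "x < mcard M"
    then show "h x < mcard (rep_table T W)" using ex[of x] h idx_less by (auto simp: table_simps)
  next
    show "h (munit M) = munit (rep_table T W)"
      using h[OF Nil_words] one by (simp add: table_simps)
  next
    fix x y assume "x < mcard M" "y < mcard M"
    then obtain u v where u: "u \<in> words T" "x = f (runrel T' u)" and v: "v \<in> words T" "y = f (runrel T' v)"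
      using ex by meson
    have "mmul M x y = f (runrel T' (u @ v))"
      using mult[OF tm tm, OF u(1) v(1)] u(2) v(2) by (simp add: runrel_append[OF wf'])
    then show "h (mmul M x y) = mmul (rep_table T W) (h x) (h y)"
      using u v h mmul_idx append_words by simp
  qed
  moreover have "h ` {..<mcard M} = {..<mcard (rep_table T W)}"
  proof
    show "h ` {..<mcard M} \<subseteq> {..<mcard (rep_table T W)}"
      using calculation by (auto simp: mhom_def)
    show "{..<mcard (rep_table T W)} \<subseteq> h ` {..<mcard M}"
    proof
      fix i assume "i \<in> {..<mcard (rep_table T W)}"
      then have i: "i < length W" by (simp add: table_simps)
      then have w: "W ! i \<in> words T" using W_words by simp
      then have "i = h (f (runrel T' (W ! i)))" using h idx_nth[OF i] by simp
      then show "i \<in> h ` {..<mcard M}" using fm[OF w] by blast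
    qed
  qed
  ultimately show ?thesis using V M fmon_table unfolding monoid_variety_def by blast
qed

end

section \<open>Valid certificates and their soundness\<close>

type_synonym certificate =
  "dft \<times> dft \<times> (nat list \<times> nat list \<times> (nat \<times> nat \<times> nat list) list) \<times> nat list list \<times> nat list list"

definition valid :: "certificate \<Rightarrow> bool" where
  "valid c = (case c of (T, T', (D, D', R), W, Z) \<Rightarrow>
     wf_dft T' \<and> ns T' = ns T \<and> simulation T T' D D' R
     \<and> distinct W \<and> (\<forall>u\<in>set W. \<forall>a\<in>set u. a < ns T')
     \<and> (\<exists>w\<in>set W. acts T' w = acts T' [])
     \<and> (\<forall>u\<in>set W. \<forall>a\<in>set [0..<ns T']. \<exists>w\<in>set W. acts T' w = acts T' (u @ [a]))
     \<and> (\<forall>u\<in>set W. \<forall>v\<in>set W. u = v \<or> (\<exists>x\<in>set Z. separated T' (x @ u) (x @ v) Z)))"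

lemma valid_sound:
  assumes V: "monoid_variety V" and wfT: "wf_dft T" and valid: "valid (T, T', DR, W, Z)"
  shows "fmon (rep_table T' W)" "V (rep_table T' W) \<longleftrightarrow> V_definable V T"
proof -
  obtain D D' R where DR: "DR = (D, D', R)" by (cases DR)
  have wf': "wf_dft T'" and ns: "ns T' = ns T" and sim: "simulation T T' D D' R"
    and W: "distinct W" "set W \<subseteq> words T'"
    and Nil: "\<exists>w\<in>set W. acts T' w = acts T' []"
    and step: "\<And>u a. u \<in> set W \<Longrightarrow> a < ns T' \<Longrightarrow> \<exists>w\<in>set W. acts T' w = acts T' (u @ [a])"
    using valid by (auto simp: valid_def DR words_def)
  have sep: "\<exists>x. separated T' (x @ u) (x @ v) Z" if "u \<in> set W" "v \<in> set W" "u \<noteq> v" for u v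
    using valid that unfolding valid_def DR prod.case by meson
  have "\<exists>w\<in>set W. acts T' w = acts T' u" if "u \<in> words T'" for u
    using that
  proof (induction u rule: rev_induct)
    case (snoc a u)
    then obtain w where w: "w \<in> set W" "runrel T' w = runrel T' u" "a < ns T'"
      by (auto simp: words_def acts_eq_iff[OF wf'])
    \<comment> \<open>Run relations compose, so the representative \<open>w\<close> may replace
      \<open>u\<close> before the last letter.\<close>
    obtain w' where "w' \<in> set W" "acts T' w' = acts T' (w @ [a])"
      using step[OF w(1,3)] by blast
    then show ?case using w(2) by (auto simp: acts_eq_iff[OF wf'] runrel_append[OF wf'])
  qed (rule Nil)
  then have "choffrut_reps T' W"
    unfolding choffrut_reps_def using wf' W separated_sound sep by meson
  then interpret choffrut T' W by unfold_locales
  show "fmon (rep_table T' W)" by (rule fmon_table)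
  have eq: "dft_fun T' = dft_fun T" by (rule simulation_sound[OF wfT wf' ns sim])
  show "V (rep_table T' W) \<longleftrightarrow> V_definable V T"
  proof
    assume "V (rep_table T' W)"
    then have "V_dft V T'" using table_tm_in wf' by (simp add: V_dft_def)
    then show "V_definable V T" unfolding V_definable_def using eq ns by auto
  next
    assume "V_definable V T"
    then obtain T'' where T'': "V_dft V T''" "ns T'' = ns T" "\<And>u. u \<in> words T \<Longrightarrow> dft_fun T'' u = dft_fun T u"
      unfolding V_definable_def by blast
    then have "dft_fun T'' = dft_fun T'"
      using dft_fun_ext[OF wfT, of T''] eq by (simp add: V_dft_def)
    then show "V (rep_table T' W)" using tm_in_table[OF V T''(1)] T''(2) ns by simp
  qed
qed

section \<open>Existence of a certificate\<close>

context residual_dft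
begin

text \<open>Each state \<open>p\<close> that is reachable and not dead is paired with the state of
  \<open>strip (out_from T p)\<close>, with \<open>lcp (out_from T p)\<close> as left factor.
  Reachability makes the stripped function the residual of a word, hence a state.\<close>

lemma ex_simulation: "\<exists>D D' R. simulation T min_dft D D' R"
proof -
  obtain D where D: "dead_set T D" "\<And>p. p < nq T \<Longrightarrow> \<forall>u. out_from T p u = None \<Longrightarrow> p \<in> set D"
    using ex_dead_set[OF wf] by blast
  obtain D' where D': "dead_set min_dft D'"
      "\<And>p. p < n \<Longrightarrow> \<forall>u. out_from min_dft p u = None \<Longrightarrow> p \<in> set D'"
    using ex_dead_set[OF wf_min] by auto
  let ?F = "out_from T"
  define R where "R = map (\<lambda>p. (p, ix (strip (?F p)), lcp (?F p)))
    (filter (\<lambda>p. (\<exists>x w. run T (q0 T) x = Some (p, w)) \<and> (\<exists>u. ?F p u \<noteq> None)) [0..<nq T])"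
  have acc: "x \<in> words T \<and> p < nq T \<and> res x = strip (?F p)" if "run T (q0 T) x = Some (p, w)" for x p w
    using run_wf[OF wf that] wf that by (simp add: words_def wf_dft_def residual_dft_fun)
  have dead': "ix (res x) \<in> set D'" if "x \<in> words T" "\<And>u. res x u = None" for x
    using D'(2) ix_less out_from_min that by simp
  \<comment> \<open>Longest common prefixes of both sides of
    \<open>prepend v (?F q) = prepend w h\<close> give the equation of \<open>related\<close>. The
    initial pair is the case \<open>w = []\<close>, \<open>h = dft_fun T\<close>; for a transition,
    \<open>h\<close> is the residual with its letter read.\<close>
  have rel: "related D D' R v q v' (ix (strip (?F q))) w"
    if x: "run T (q0 T) x = Some (q, y)" and eq: "prepend v (?F q) = prepend w h" and v': "v' = lcp h"
    for v q w y x h v'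
  proof (cases "\<forall>u. ?F q u = None")
    case True
    then have "\<And>u. res x u = None" using acc[OF x] by simp
    then have "ix (res x) \<in> set D'" using dead' acc[OF x] by blast
    then show ?thesis using D(2)[OF _ True] acc[OF x] by (simp add: related_def)
  next
    case False
    then obtain u where u: "?F q u \<noteq> None" by blast
    have "prepend w h u \<noteq> None" using u fun_cong[OF eq, of u] by (metis prepend_None_iff)
    then have "h u \<noteq> None" by simp
    then have "w @ v' = v @ lcp (?F q)"
      using lcp_prepend[of h u w] lcp_prepend[of "?F q" u v] u eq v' by simp
    moreover have "(q, ix (strip (?F q)), lcp (?F q)) \<in> set R"
      using u x acc[OF x] unfolding R_def by auto
    ultimately show ?thesis unfolding related_def by (intro disjI2 bexI) auto
  qed
  have "simulation T min_dft D D' R"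
    unfolding simulation_def
  proof (intro conjI D(1) D'(1) ballI, safe)
    have e: "prepend (iout T) (?F (q0 T)) = prepend [] (dft_fun T)"
      by (simp add: dft_fun_out_from)
    have "res [] = strip (?F (q0 T))" by (simp add: residual_dft_fun)
    then show "related D D' R (iout T) (q0 T) (iout min_dft) (q0 min_dft) []"
      using rel[of "[]" "q0 T" "[]", OF _ e refl] by simp
  next
    fix p p' w assume "(p, p', w) \<in> set R"
    then obtain x y where x: "run T (q0 T) x = Some (p, y)" and p': "p' = ix (strip (?F p))" and w: "w = lcp (?F p)"
      by (auto simp: R_def)
    have xw: "x \<in> words T" and res: "res x = strip (?F p)" using acc[OF x] by simp_all
    show "map_of (fout T) p = map_option ((@) w) (map_of (fout min_dft) p')"
      using fun_cong[OF prepend_lcp_strip[of "?F p"], of "[]"] map_of_fout_min[OF xw] res p' w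
      by (simp add: prepend_def)
    fix a assume "a \<in> set [0..<ns T]"
    then have a: "a < ns T" by simp
    have m: "map_of (delta min_dft) (p', a) = Some (ix (res (x @ [a])), lcp (\<lambda>z. strip (?F p) (a # z)))"
      using map_of_delta_min[OF xw, of a] a res p' by simp
    show "case map_of (delta T) (p, a) of
             None \<Rightarrow> (case map_of (delta min_dft) (p', a) of None \<Rightarrow> True | Some (q', v') \<Rightarrow> q' \<in> set D')
           | Some (q, v) \<Rightarrow> (case map_of (delta min_dft) (p', a) of None \<Rightarrow> q \<in> set D
               | Some (q', v') \<Rightarrow> related D D' R v q v' q' w)"
    proof (cases "map_of (delta T) (p, a)")
      case None
      \<comment> \<open>\<open>T\<close> blocks, so the residual is nowhere defined and
        \<open>min_dft\<close> enters a dead state.\<close>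
      have "run T (q0 T) (x @ [a]) = None" using x None by (simp add: run_append)
      then have "res (x @ [a]) = (\<lambda>_. None)" by (simp add: residual_dft_fun)
      then have "ix (res (x @ [a])) \<in> set D'" using dead' snoc_words[OF xw a] by metis
      then show ?thesis using None m by simp
    next
      case (Some qv)
      obtain q v where qv: "qv = (q, v)" by (cases qv)
      have x': "run T (q0 T) (x @ [a]) = Some (q, y @ v)" using x Some qv by (simp add: run_append)
      have "prepend v (?F q) z = prepend w (\<lambda>z. strip (?F p) (a # z)) z" for z
        using fun_cong[OF prepend_lcp_strip[of "?F p"], of "a # z"] Some qv w by (simp add: prepend_def)
      then have "prepend v (?F q) = prepend w (\<lambda>z. strip (?F p) (a # z))" by blast
      from rel[OF x' this refl] show ?thesis using Some qv m acc[OF x'] by simp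
    qed
  qed
  then show ?thesis by blast
qed

text \<open>A transversal of the actions, finite since actions are lists of length \<open>n\<close>
  over \<open>{..n}\<close>.\<close>

lemma ex_reps:
  obtains W where "distinct W" "set W \<subseteq> words T"
    "\<And>u. u \<in> words T \<Longrightarrow> \<exists>w\<in>set W. acts min_dft w = acts min_dft u"
    "\<And>u v. u \<in> set W \<Longrightarrow> v \<in> set W \<Longrightarrow> acts min_dft u = acts min_dft v \<Longrightarrow> u = v"
proof -
  have "acts min_dft ` words T \<subseteq> {xs. set xs \<subseteq> {..n} \<and> length xs = n}"
  proof (rule image_subsetI)
    fix u
    have "(case run min_dft p u of None \<Rightarrow> nq min_dft | Some (q, w) \<Rightarrow> q) \<le> n" if "p < n" for p
      using run_wf(3)[OF wf_min, of p u] that by (auto split: option.splits intro: less_imp_le)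
    then show "acts min_dft u \<in> {xs. set xs \<subseteq> {..n} \<and> length xs = n}"
      by (auto simp: acts_def)
  qed
  then have fin: "finite (acts min_dft ` words T)"
    by (rule finite_subset) (rule finite_lists_length_eq, simp)
  obtain C where C: "C \<subseteq> words T" "inj_on (acts min_dft) C" "acts min_dft ` words T = acts min_dft ` C"
    using subset_image_inj[of "acts min_dft ` words T" "acts min_dft" "words T"] by auto
  then have "finite C" using fin finite_image_iff by metis
  then obtain W where W: "set W = C" "distinct W" using finite_distinct_list by blast
  show ?thesis
  proof (rule that[OF W(2)])
    fix u assume "u \<in> words T"
    then have "acts min_dft u \<in> acts min_dft ` set W" using C(3) W(1) by blast
    then show "\<exists>w\<in>set W. acts min_dft w = acts min_dft u" by (metis imageE)
  qed (use C W(1) in \<open>auto dest: inj_onD\<close>)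
qed

lemma ex_certificate: "\<exists>DR W Z. valid (T, min_dft, DR, W, Z)"
proof -
  obtain D D' R where sim: "simulation T min_dft D D' R" using ex_simulation by blast
  obtain W where W: "distinct W" "set W \<subseteq> words T"
    and all: "\<And>u. u \<in> words T \<Longrightarrow> \<exists>w\<in>set W. acts min_dft w = acts min_dft u"
    and inj: "\<And>u v. u \<in> set W \<Longrightarrow> v \<in> set W \<Longrightarrow> acts min_dft u = acts min_dft v \<Longrightarrow> u = v"
    by (rule ex_reps) blast
  have "\<exists>x Z. u = v \<or> separated min_dft (x @ u) (x @ v) Z" if uv: "u \<in> set W" "v \<in> set W" for u v
  proof (cases "u = v")
    case False
    then have "runrel min_dft u \<noteq> runrel min_dft v" using inj uv acts_eq_iff[OF wf_min] by blast
    then obtain x where "res (x @ u) \<noteq> res (x @ v)"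
      using runrel_min_cong uv W(2) by blast
    then show ?thesis using separated_complete[of min_dft "x @ u" "x @ v"] by (auto simp: dft_fun_min)
  qed simp
  then obtain xf Zf where sep: "\<And>u v. u \<in> set W \<Longrightarrow> v \<in> set W \<Longrightarrow>
      u = v \<or> separated min_dft (xf u v @ u) (xf u v @ v) (Zf u v)"
    by metis
  \<comment> \<open>One pool of contexts and test words for all pairs, as
    \<open>separated_mono\<close> permits.\<close>
  define Z where "Z = concat (map (\<lambda>(u, v). xf u v # Zf u v) (List.product W W))"
  have Z: "xf u v \<in> set Z" "set (Zf u v) \<subseteq> set Z" if "u \<in> set W" "v \<in> set W" for u v
    using that by (auto simp: Z_def)
  have "u = v \<or> (\<exists>x\<in>set Z. separated min_dft (x @ u) (x @ v) Z)" if "u \<in> set W" "v \<in> set W" for u v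
    using sep[OF that] Z[OF that] separated_mono by blast
  moreover have "\<exists>w\<in>set W. acts min_dft w = acts min_dft (u @ [a])" if "u \<in> set W" "a < ns T" for u a
    using all snoc_words that W(2) by blast
  moreover have "\<forall>u\<in>set W. \<forall>a\<in>set u. a < ns T" using W(2) by (auto simp: words_def)
  ultimately have "valid (T, min_dft, (D, D', R), W, Z)"
    unfolding valid_def using sim wf_min W(1) all[OF Nil_words] by simp
  then show ?thesis by blast
qed

end

section \<open>Search for a certificate\<close>

lemma sexp_nat_inject: "sexp_nat x = sexp_nat y \<longleftrightarrow> x = y"
proof
  show "sexp_nat x = sexp_nat y \<Longrightarrow> x = y"
  proof (induction x arbitrary: y rule: sexp_nat.induct)
    case (1 n)
    then show ?case by (cases y) auto
  next
    case (2 xs)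
    then obtain ys where y: "y = Lst ys" "map sexp_nat xs = map sexp_nat ys"
      by (cases y) (auto simp: list_encode_eq)
    have "xs = ys"
      by (rule list.inj_map_strong[OF _ y(2)]) (use 2 in blast)
    then show ?case using y by simp
  qed
qed simp

instantiation sexp :: coded
begin
text \<open>Chosen so that codes coincide with the inputs prescribed by
  \<open>decides\<close>.\<close>

definition gn_sexp :: "sexp \<Rightarrow> nat" where "gn_sexp = sexp_nat"
instance by standard (simp add: gn_sexp_def sexp_nat_inject)
end

text \<open>Certificates are matched to the input by encoding; injectivity identifies the transducer
  found with the input.\<close>

lemma enc_dft_inject: "enc_dft T = enc_dft T' \<longleftrightarrow> T = T'"
proof
  have natlist: "natlist xs = natlist ys \<Longrightarrow> xs = ys" for xs ys
    by (auto simp: natlist_def map_injective inj_def)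
  have "inj (\<lambda>((p,a),(q,w)). Lst [Atom p, Atom a, Atom q, natlist w])"
    and "inj (\<lambda>(q,t). Lst [Atom q, natlist t])"
    by (auto simp: inj_def dest: natlist)
  then show "enc_dft T = enc_dft T' \<Longrightarrow> T = T'"
    by (intro dft.expand) (auto simp: enc_dft_def dest: natlist map_injective)
qed simp

section \<open>Computability of the validity check\<close>

lemma computable_Atom [comp_intros]: "computable f \<Longrightarrow> computable (\<lambda>x. Atom (f x))"
  by (elim computableE)
     (rule computableI[OF total_recursive_pair[OF total_recursive_const[of 0]]], auto simp: gn_sexp_def)

lemma computable_Lst [comp_intros]: "computable f \<Longrightarrow> computable (\<lambda>x. Lst (f x))"
proof -
  have [simp]: "(gn :: sexp \<Rightarrow> nat) = sexp_nat" by (simp add: gn_sexp_def fun_eq_iff)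
  show "computable f \<Longrightarrow> computable (\<lambda>x. Lst (f x))"
    by (elim computableE)
       (rule computableI[OF total_recursive_pair[OF total_recursive_const[of 1]]], auto simp: gn_list_def)
qed

lemma computable_natlist [comp_intros]: "computable f \<Longrightarrow> computable (\<lambda>x. natlist (f x))"
proof -
  have "computable natlist" unfolding natlist_def[abs_def] by (intro comp_intros)
  then show "computable f \<Longrightarrow> computable (\<lambda>x. natlist (f x))" by (rule computable_comp)
qed

lemma computable_dft_sel:
  "computable nq" "computable ns" "computable q0" "computable iout" "computable delta" "computable fout"
proof -
  let ?t = "\<lambda>T. (nq T, ns T, q0 T, iout T, delta T, fout T)"
  have t: "computable ?t"
    by (rule computableI[OF total_recursive_id]) (simp add: gn_dft_def)
  have "computable (\<lambda>T. fst (?t T))" "computable (\<lambda>T. fst (snd (?t T)))"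
    "computable (\<lambda>T. fst (snd (snd (?t T))))" "computable (\<lambda>T. fst (snd (snd (snd (?t T)))))"
    "computable (\<lambda>T. fst (snd (snd (snd (snd (?t T))))))"
    "computable (\<lambda>T. snd (snd (snd (snd (snd (?t T))))))"
    by (intro computable_fst computable_snd t)+
  then show "computable nq" "computable ns" "computable q0" "computable iout" "computable delta"
    "computable fout" by simp_all
qed

lemmas [comp_intros] = computable_dft_sel[THEN computable_comp]

lemma computable_enc_dft [comp_intros]: "computable f \<Longrightarrow> computable (\<lambda>x. enc_dft (f x))"
proof -
  have "computable enc_dft" unfolding enc_dft_def[abs_def] by (intro comp_intros)
  then show "computable f \<Longrightarrow> computable (\<lambda>x. enc_dft (f x))" by (rule computable_comp)
qed

lemma map_of_foldr: "map_of ps k = foldr (\<lambda>p s. if fst p = k then Some (snd p) else s) ps None"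
  by (induction ps) auto

lemma computable_map_of [comp_intros]:
  "computable f \<Longrightarrow> computable g \<Longrightarrow> computable (\<lambda>x. map_of (f x) (g x))"
proof -
  have "computable (\<lambda>z. map_of (fst z) (snd z))"
    unfolding map_of_foldr by (intro comp_intros)
  from computable_comp[OF this computable_Pair] show
    "computable f \<Longrightarrow> computable g \<Longrightarrow> computable (\<lambda>x. map_of (f x) (g x))" by simp
qed

lemma drop_rec_nat: "drop n xs = rec_nat xs (\<lambda>_ ys. case ys of [] \<Rightarrow> [] | y # zs \<Rightarrow> zs) n"
proof (induction n)
  case (Suc n)
  have "drop (Suc n) xs = tl (drop n xs)" by (simp add: drop_Suc tl_drop)
  then show ?case using Suc by (simp add: tl_def)
qed simp

lemma computable_drop [comp_intros]:
  "computable f \<Longrightarrow> computable g \<Longrightarrow> computable (\<lambda>x. drop (f x) (g x))"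
proof -
  have "computable (\<lambda>z. drop (fst z) (snd z))"
    unfolding drop_rec_nat by (intro comp_intros)
  from computable_comp[OF this computable_Pair] show
    "computable f \<Longrightarrow> computable g \<Longrightarrow> computable (\<lambda>x. drop (f x) (g x))" by simp
qed

lemma take_drop_rev: "take n xs = rev (drop (length xs - n) (rev xs))"
  by (cases "n \<le> length xs") (simp_all add: drop_rev)

lemma computable_take [comp_intros]:
  "computable f \<Longrightarrow> computable g \<Longrightarrow> computable (\<lambda>x. take (f x) (g x))"
proof -
  have "computable (\<lambda>z. take (fst z) (snd z))"
    unfolding take_drop_rev by (intro comp_intros)
  from computable_comp[OF this computable_Pair] show
    "computable f \<Longrightarrow> computable g \<Longrightarrow> computable (\<lambda>x. take (f x) (g x))" by simp
qed

lemma computable_distinct [comp_intros]: "computable f \<Longrightarrow> computable (\<lambda>x. distinct (f x))"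
proof -
  let ?g = "\<lambda>y s. (y # fst s, y \<notin> set (fst s) \<and> snd s)"
  have "foldr ?g xs ([], True) = (xs, distinct xs)" for xs :: "'b list" by (induction xs) auto
  moreover have "computable (\<lambda>xs. snd (foldr ?g (xs :: 'b list) ([], True)))" by (intro comp_intros)
  ultimately have "computable (distinct :: 'b list \<Rightarrow> bool)" by simp
  then show "computable f \<Longrightarrow> computable (\<lambda>x. distinct (f x))" by (rule computable_comp)
qed

text \<open>In \<open>run\<close> the state changes along the recursive calls. Reading from the left
  makes it part of the accumulator, which \<open>computable_fold\<close> covers.\<close>

lemma run_fold:
  "run T p u = fold (\<lambda>a s. case s of None \<Rightarrow> None | Some (q, w) \<Rightarrow>
     (case map_of (delta T) (q, a) of None \<Rightarrow> None | Some (r, w') \<Rightarrow> Some (r, w @ w'))) u (Some (p, []))"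
proof (induction u rule: rev_induct)
  case (snoc a u)
  then show ?case by (auto simp: run_append split: option.splits)
qed simp

lemma computable_run [comp_intros]:
  "computable f \<Longrightarrow> computable g \<Longrightarrow> computable h \<Longrightarrow> computable (\<lambda>x. run (f x) (g x) (h x))"
proof -
  have "computable (\<lambda>z. run (fst z) (fst (snd z)) (snd (snd z)))"
    unfolding run_fold by (intro comp_intros)
  from computable_comp[OF this computable_Pair[OF _ computable_Pair]] show
    "computable f \<Longrightarrow> computable g \<Longrightarrow> computable h \<Longrightarrow> computable (\<lambda>x. run (f x) (g x) (h x))" by simp
qed

lemma computable_dft_fun [comp_intros]:
  "computable f \<Longrightarrow> computable g \<Longrightarrow> computable (\<lambda>x. dft_fun (f x) (g x))"
proof -
  have "computable (\<lambda>z. dft_fun (fst z) (snd z))" unfolding dft_fun_def by (intro comp_intros)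
  from computable_comp[OF this computable_Pair] show
    "computable f \<Longrightarrow> computable g \<Longrightarrow> computable (\<lambda>x. dft_fun (f x) (g x))" by simp
qed

lemma computable_acts [comp_intros]:
  "computable f \<Longrightarrow> computable g \<Longrightarrow> computable (\<lambda>x. acts (f x) (g x))"
proof -
  have "computable (\<lambda>z. acts (fst z) (snd z))" unfolding acts_def by (intro comp_intros)
  from computable_comp[OF this computable_Pair] show
    "computable f \<Longrightarrow> computable g \<Longrightarrow> computable (\<lambda>x. acts (f x) (g x))" by simp
qed

lemma computable_wf_dft [comp_intros]: "computable f \<Longrightarrow> computable (\<lambda>x. wf_dft (f x))"
proof -
  have "computable wf_dft"
    unfolding wf_dft_def[abs_def] subset_eq lessThan_iff by (intro comp_intros)
  then show "computable f \<Longrightarrow> computable (\<lambda>x. wf_dft (f x))" by (rule computable_comp)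
qed

lemma computable_separated [comp_intros]:
  "computable f \<Longrightarrow> computable g \<Longrightarrow> computable h \<Longrightarrow> computable k
     \<Longrightarrow> computable (\<lambda>x. separated (f x) (g x) (h x) (k x))"
proof -
  have "computable (\<lambda>z. separated (fst z) (fst (snd z)) (fst (snd (snd z))) (snd (snd (snd z))))"
    unfolding separated_def agree_def by (intro comp_intros)
  from computable_comp[OF this computable_Pair[OF _ computable_Pair[OF _ computable_Pair]]] show
    "computable f \<Longrightarrow> computable g \<Longrightarrow> computable h \<Longrightarrow> computable k
     \<Longrightarrow> computable (\<lambda>x. separated (f x) (g x) (h x) (k x))" by simp
qed

lemma computable_valid: "computable valid"
  unfolding valid_def[abs_def] simulation_def dead_set_def related_def
  by (intro comp_intros)

lemma computable_idx [comp_intros]: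
  "computable f \<Longrightarrow> computable g \<Longrightarrow> computable h \<Longrightarrow> computable (\<lambda>x. idx (f x) (g x) (h x))"
proof -
  have "computable (\<lambda>z. idx (fst z) (fst (snd z)) (snd (snd z)))"
    unfolding idx_def by (intro comp_intros)
  from computable_comp[OF this computable_Pair[OF _ computable_Pair]] show
    "computable f \<Longrightarrow> computable g \<Longrightarrow> computable h \<Longrightarrow> computable (\<lambda>x. idx (f x) (g x) (h x))" by simp
qed

text \<open>An \<open>mtable\<close> contains a function and has no code, so only the composite with
  \<open>enc_mtable\<close> is compiled, with lookups by index turned into maps over
  \<open>W\<close>.\<close>

lemma computable_enc_table: "computable (\<lambda>z. enc_mtable (rep_table (fst z) (snd z)))"
proof -
  have nth: "map (\<lambda>i. F (W ! i)) [0..<length W] = map F W" for F :: "nat list \<Rightarrow> 'b" and W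
    by (rule nth_equalityI) auto
  have "enc_mtable (rep_table T W) = Lst [Atom (length W), Atom (idx T W []),
      Lst (map (\<lambda>u. natlist (map (\<lambda>v. idx T W (u @ v)) W)) W)]" for T W
    unfolding nth[of "\<lambda>u. natlist (map (\<lambda>v. idx T W (u @ v)) W)" W, symmetric]
    unfolding nth[of "\<lambda>v. idx T W (_ @ v)" W, symmetric]
    by (simp add: enc_mtable_def rep_table_def)
  moreover have "computable (\<lambda>z. Lst [Atom (length (snd z)), Atom (idx (fst z) (snd z) []),
      Lst (map (\<lambda>u. natlist (map (\<lambda>v. idx (fst z) (snd z) (u @ v)) (snd z))) (snd z))])"
    by (intro comp_intros)
  ultimately show ?thesis by simp
qed

section \<open>Unbounded search and the decision procedure\<close>

lemma surj_gn_certificate: "surj (gn :: certificate \<Rightarrow> nat)"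
  by (intro surj_gn_prod surj_gn_list surj_gn_nat surj_gn_dft)

text \<open>The algorithm \<open>f\<close> need only halt on the codes of the objects that the search can find.\<close>
lemma search_then:
  fixes Q :: "nat \<times> 'c::coded \<Rightarrow> bool" and k :: "'c \<Rightarrow> nat"
  assumes surj: "surj (gn :: 'c \<Rightarrow> nat)" and Q: "computable Q" and k: "computable k"
  shows "\<exists>g. \<forall>t y. (\<exists>c. Q (t, c)) \<longrightarrow> (\<forall>c. Q (t, c) \<longrightarrow> eval_rf f [k c] y) \<longrightarrow> eval_rf g [t] y"
proof -
  \<comment> \<open>Negated, since \<open>Mn\<close> looks for the value 0, the code of
    \<open>False\<close>.\<close>
  obtain F where "total_recursive F" and F: "\<And>z. F (gn z) = gn (\<not> Q z)"
    using computable_not[OF Q] unfolding computable_def by blast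
  then obtain r where r: "\<And>n. eval_rf r [n] (F n)" unfolding total_recursive_def by blast
  obtain K where "total_recursive K" and K: "\<And>c. K (gn c) = k c"
    using k by (auto simp: computable_def)
  then obtain s where s: "\<And>n. eval_rf s [n] (K n)" unfolding total_recursive_def by blast
  let ?b = "Comp r [Comp rf_pair [Proj 1, Proj 0]]"
  have b: "eval_rf ?b [n, t] (F (prod_encode (t, n)))" for n t
    by (auto intro!: eval_Comp1 eval_Comp2 eval_Proj eval_pair r)
  have Fc: "F (prod_encode (t, gn c)) = gn (\<not> Q (t, c))" for t c
    using F[of "(t, c)"] by (simp add: gn_prod_def)
  have "eval_rf (Comp f [Comp s [Mn ?b]]) [t] y"
    if ex: "\<exists>c. Q (t, c)" and y: "\<forall>c. Q (t, c) \<longrightarrow> eval_rf f [k c] y" for t y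
  proof -
    let ?P = "\<lambda>n. F (prod_encode (t, n)) = 0"
    define m where "m = (LEAST n. ?P n)"
    obtain c0 where "Q (t, c0)" using ex by blast
    then have "?P (gn c0)" by (simp add: Fc gn_bool_def)
    then have m: "?P m" unfolding m_def by (rule LeastI)
    \<comment> \<open>The least zero may differ from the code of \<open>c0\<close>; surjectivity
      makes it the code of some candidate.\<close>
    obtain c :: 'c where c: "m = gn c" using surj by (meson surjD)
    then have "Q (t, c)" using m by (simp add: Fc gn_bool_def split: if_splits)
    then have "eval_rf f [K m] y" using y by (simp add: c K)
    moreover have "eval_rf (Mn ?b) [t] m"
    proof (rule ev_Mn)
      show "eval_rf ?b [m, t] 0" using b[of m t] m by simp
      show "\<forall>n<m. \<exists>y. 0 < y \<and> eval_rf ?b [n, t] y"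
        using b not_less_Least[of _ ?P] unfolding m_def by (metis gr0I)
    qed
    ultimately show ?thesis by (meson eval_Comp1 s)
  qed
  then show ?thesis by blast
qed

theorem mainTheorem6:
  fixes V :: "mtable \<Rightarrow> bool"
  assumes "monoid_variety V"
    and "\<exists>f. decides f enc_mtable fmon V"
  shows "\<exists>g. decides g enc_dft wf_dft (V_definable V)"
proof -
  obtain f where f: "\<And>M. fmon M \<Longrightarrow> eval_rf f [sexp_nat (enc_mtable M)] (if V M then 1 else 0)"
    using assms(2) unfolding decides_def by blast
  let ?Q = "\<lambda>z :: nat \<times> certificate. valid (snd z) \<and> gn (enc_dft (fst (snd z))) = fst z"
  let ?k = "\<lambda>c :: certificate. gn (enc_mtable (rep_table (fst (snd c)) (fst (snd (snd (snd c))))))"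
  have Q: "computable ?Q"
    by (intro comp_intros computable_comp[OF computable_valid] computable_gn)
  have k: "computable ?k"
  proof (rule computable_gn)
    have "computable (\<lambda>c :: certificate. (fst (snd c), fst (snd (snd (snd c)))))"
      by (intro comp_intros)
    from computable_comp[OF computable_enc_table this]
    show "computable (\<lambda>c :: certificate. enc_mtable (rep_table (fst (snd c)) (fst (snd (snd (snd c))))))"
      by simp
  qed
  obtain g where g: "\<forall>t y. (\<exists>c. ?Q (t, c)) \<longrightarrow> (\<forall>c. ?Q (t, c) \<longrightarrow> eval_rf f [?k c] y) \<longrightarrow> eval_rf g [t] y"
    using search_then[OF surj_gn_certificate Q k, of f] by (elim exE)
  have "eval_rf g [sexp_nat (enc_dft T)] (if V_definable V T then 1 else 0)" if wf: "wf_dft T" for T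
  proof (rule g[rule_format])
    \<comment> \<open>\<open>min_dft\<close> enters only here, to show that the search
      succeeds.\<close>
    obtain ix where "residual_dft T ix" using ex_residual_dft[OF wf] by blast
    then interpret residual_dft T ix .
    obtain DR W Z where "valid (T, min_dft, DR, W, Z)" using ex_certificate by blast
    then have "?Q (sexp_nat (enc_dft T), (T, min_dft, DR, W, Z))" by (simp add: gn_sexp_def)
    then show "\<exists>c. ?Q (sexp_nat (enc_dft T), c)" by blast
  next
    fix c :: certificate assume c: "?Q (sexp_nat (enc_dft T), c)"
    obtain T0 T' DR W Z where c': "c = (T0, T', DR, W, Z)" by (cases c)
    have "T0 = T" using c c' by (simp add: gn_sexp_def sexp_nat_inject enc_dft_inject)
    \<comment> \<open>The certificate found may contain a \<open>T'\<close> other than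
      \<open>min_dft\<close>; soundness covers every valid one.\<close>
    then have v: "valid (T, T', DR, W, Z)" using c c' by simp
    show "eval_rf f [?k c] (if V_definable V T then 1 else 0)"
      using f[OF valid_sound(1)[OF assms(1) wf v]] valid_sound(2)[OF assms(1) wf v] c'
      by (simp add: gn_sexp_def)
  qed
  then show ?thesis unfolding decides_def by blast
qed

end
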